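(* Let $P$ be a finite ordered set with at least $4$ elements that has a minmax pair of pseudo-similar points. Then $P$ is reconstructible; that is, every ordered set $Q$ with $\mathcal{D}_Q=\mathcal{D}_P$ is isomorphic to $P$.
   Context: For a finite ordered set $P$ and $x\in P$, the card $P\setminus\{x\}$ is the induced ordered subset considered up to isomorphism. The deck of $P$ is the multiset $\mathcal{D}_P=\langle P\setminus\{x\}:x\in P\rangle$ of isomorphism types of cards. An ordered set $P$ has a minmax pair $(l,h)$ of pseudo-similar points iff $l$ is a minimal element of $P$, $h$ is a maximal element of $P$, and $P\setminus\{h\}$ is isomorphic to $P\setminus\{l\}$. *)

theory Defs
  imports Main "HOL-Library.Multiset"
begin

text \<open>
  An ordered set is a relation \<open>P\<close> with \<open>Partial_order P\<close>. Such a relation is reflexive on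
  \<open>Field P\<close>, so \<open>Field P\<close> is the underlying set, isolated points included. \<open>Main\<close> defines
  \<open>iso P Q f\<close> through initial segments; for ordered sets it says exactly that \<open>f\<close> is a
  bijection of the underlying sets that preserves and reflects the order (\<open>iso_iff2\<close>).
\<close>

definition isomorphic :: "'a rel \<Rightarrow> 'b rel \<Rightarrow> bool" where
  "isomorphic P Q \<longleftrightarrow> (\<exists>f. iso P Q f)"

definition delete_point :: "'a rel \<Rightarrow> 'a \<Rightarrow> 'a rel" where
  "delete_point P x = Restr P (Field P - {x})"

text \<open>
  The isomorphism type of a finite ordered set is the class of all its isomorphic copies on
  sets of natural numbers. This makes the types of ordered sets over different HOL types
  comparable; \<open>iso_type_eq_iff\<close> below shows that no information is lost.
\<close>

definition iso_type :: "'a rel \<Rightarrow> nat rel set" where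
  "iso_type P = {R. Partial_order R \<and> isomorphic P R}"

text \<open>
  Since \<open>mset_set\<close> of an infinite set is empty, so is the deck of an infinite ordered set;
  it therefore never equals the deck of a nonempty finite one.
\<close>

definition deck :: "'a rel \<Rightarrow> nat rel set multiset" where
  "deck P = image_mset (\<lambda>x. iso_type (delete_point P x)) (mset_set (Field P))"

definition minimal_point :: "'a rel \<Rightarrow> 'a \<Rightarrow> bool" where
  "minimal_point P l \<longleftrightarrow> l \<in> Field P \<and> (\<forall>y. (y, l) \<in> P \<longrightarrow> y = l)"

definition maximal_point :: "'a rel \<Rightarrow> 'a \<Rightarrow> bool" where
  "maximal_point P h \<longleftrightarrow> h \<in> Field P \<and> (\<forall>y. (h, y) \<in> P \<longrightarrow> y = h)"

definition minmax_pseudo_similar :: "'a rel \<Rightarrow> 'a \<Rightarrow> 'a \<Rightarrow> bool" where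
  "minmax_pseudo_similar P l h \<longleftrightarrow>
     minimal_point P l \<and> maximal_point P h \<and>
     isomorphic (delete_point P h) (delete_point P l)"

lemma isomorphic_refl: "isomorphic P P"
  unfolding isomorphic_def iso_iff2 by (rule exI[of _ id]) auto

lemma isomorphic_sym:
  assumes "isomorphic P Q" shows "isomorphic Q P"
proof -
  obtain f where f: "bij_betw f (Field P) (Field Q)"
    and o: "\<forall>a\<in>Field P. \<forall>b\<in>Field P. (a, b) \<in> P \<longleftrightarrow> (f a, f b) \<in> Q"
    using assms unfolding isomorphic_def iso_iff2 by auto
  let ?g = "inv_into (Field P) f"
  have g: "bij_betw ?g (Field Q) (Field P)" using f by (rule bij_betw_inv_into)
  have "(a, b) \<in> Q \<longleftrightarrow> (?g a, ?g b) \<in> P" if "a \<in> Field Q" "b \<in> Field Q" for a b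
    using that o bij_betw_inv_into_right[OF f] bij_betwE[OF g] by auto
  with g show ?thesis unfolding isomorphic_def iso_iff2 by blast
qed

lemma isomorphic_trans:
  assumes "isomorphic P Q" "isomorphic Q R" shows "isomorphic P R"
proof -
  obtain f g where f: "bij_betw f (Field P) (Field Q)" and g: "bij_betw g (Field Q) (Field R)"
    and of: "\<forall>a\<in>Field P. \<forall>b\<in>Field P. (a, b) \<in> P \<longleftrightarrow> (f a, f b) \<in> Q"
    and og: "\<forall>a\<in>Field Q. \<forall>b\<in>Field Q. (a, b) \<in> Q \<longleftrightarrow> (g a, g b) \<in> R"
    using assms unfolding isomorphic_def iso_iff2 by auto
  have "bij_betw (g \<circ> f) (Field P) (Field R)" using f g by (rule bij_betw_trans)
  moreover have "(a, b) \<in> P \<longleftrightarrow> ((g \<circ> f) a, (g \<circ> f) b) \<in> R"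
    if "a \<in> Field P" "b \<in> Field P" for a b
    using that of og bij_betwE[OF f] by auto
  ultimately show ?thesis unfolding isomorphic_def iso_iff2 by blast
qed

lemma iso_type_nonempty:
  assumes P: "Partial_order P" and fin: "finite (Field P)"
  shows "iso_type P \<noteq> {}"
proof -
  obtain f :: "'a \<Rightarrow> nat" where inj: "inj_on f (Field P)"
    using finite_imp_inj_to_nat_seg[OF fin] by blast
  define R where "R = {(f a, f b) | a b. (a, b) \<in> P}"
  have refl: "(a, a) \<in> P" if "a \<in> Field P" for a
    using P that by (auto simp: order_on_defs dest: refl_onD)
  have tr: "trans P" and as: "antisym P"
    using P by (auto simp: order_on_defs)
  have RE: "\<exists>a b. x = f a \<and> y = f b \<and> (a, b) \<in> P \<and> a \<in> Field P \<and> b \<in> Field P"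
    if "(x, y) \<in> R" for x y
    using that unfolding R_def by (blast intro: FieldI1 FieldI2)
  have RI: "(f a, f b) \<in> R" if "(a, b) \<in> P" for a b
    using that unfolding R_def by blast
  have fld: "Field R = f ` Field P"
  proof (rule set_eqI, rule iffI)
    fix x assume "x \<in> Field R"
    then obtain y where "(x, y) \<in> R \<or> (y, x) \<in> R" unfolding Field_def by blast
    then show "x \<in> f ` Field P" using RE by blast
  next
    fix x assume "x \<in> f ` Field P"
    then obtain a where "x = f a" "a \<in> Field P" by blast
    then have "(x, x) \<in> R" using RI refl by blast
    then show "x \<in> Field R" by (rule FieldI1)
  qed
  have mem: "(f a, f b) \<in> R \<longleftrightarrow> (a, b) \<in> P" if ab: "a \<in> Field P" "b \<in> Field P" for a b
  proof
    assume "(f a, f b) \<in> R"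
    then obtain a' b' where *: "f a = f a'" "f b = f b'" "(a', b') \<in> P" "a' \<in> Field P" "b' \<in> Field P"
      using RE by blast
    then have "a = a'" "b = b'" using inj_onD[OF inj] ab by blast+
    then show "(a, b) \<in> P" using * by blast
  qed (rule RI)
  have "R \<subseteq> Field R \<times> Field R" by (auto intro: FieldI1 FieldI2)
  moreover have "refl_on (Field R) R"
  proof (rule refl_onI)
    fix x assume "x \<in> Field R"
    then obtain a where "x = f a" "a \<in> Field P" unfolding fld by blast
    then show "(x, x) \<in> R" using RI[OF refl] by simp
  qed
  moreover have "trans R"
  proof (rule transI)
    fix x y z assume xy: "(x, y) \<in> R" and yz: "(y, z) \<in> R"
    obtain a b where ab: "x = f a" "y = f b" "(a, b) \<in> P" "b \<in> Field P"
      using RE[OF xy] by blast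
    obtain b' c where bc: "y = f b'" "z = f c" "(b', c) \<in> P" "b' \<in> Field P"
      using RE[OF yz] by blast
    have "f b = f b'" using ab bc by simp
    then have "b = b'" using inj ab bc by (simp add: inj_on_eq_iff)
    then have "(a, c) \<in> P" using transD[OF tr ab(3)] bc by simp
    then show "(x, z) \<in> R" using RI ab bc by simp
  qed
  moreover have "antisym R"
  proof (rule antisymI)
    fix x y assume xy: "(x, y) \<in> R" and yx: "(y, x) \<in> R"
    obtain a b where ab: "x = f a" "y = f b" "(a, b) \<in> P" "a \<in> Field P" "b \<in> Field P"
      using RE[OF xy] by blast
    have "(b, a) \<in> P" using yx ab mem by simp
    then have "a = b" using antisymD[OF as ab(3)] by simp
    then show "x = y" using ab by simp
  qed
  ultimately have "Partial_order R" unfolding order_on_defs by simp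
  moreover have "iso P R f"
    unfolding iso_iff2 bij_betw_def using inj fld mem by simp
  ultimately show ?thesis unfolding iso_type_def isomorphic_def by blast
qed

lemma iso_type_eq_iff:
  assumes "Partial_order P" "finite (Field P)"
  shows "iso_type P = iso_type Q \<longleftrightarrow> isomorphic P Q"
proof
  assume eq: "iso_type P = iso_type Q"
  obtain R where "R \<in> iso_type P" using iso_type_nonempty[OF assms] by blast
  with eq have "isomorphic P R" "isomorphic Q R" by (auto simp: iso_type_def)
  then show "isomorphic P Q" using isomorphic_trans[OF _ isomorphic_sym] by blast
next
  assume PQ: "isomorphic P Q"
  have "isomorphic P R \<longleftrightarrow> isomorphic Q R" for R :: "nat rel"
    using isomorphic_trans[OF PQ] isomorphic_trans[OF isomorphic_sym[OF PQ]] by blast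
  then show "iso_type P = iso_type Q" unfolding iso_type_def by simp
qed

end

theory Submission
  imports Defs
begin

text \<open>
  By Kelly's lemma the deck determines the number of copies of every connected proper suborder of
  \<open>P\<close>, hence \<open>P\<close> itself if \<open>P\<close> is disconnected: split off a largest component again and again.

  Let \<open>P\<close> be connected and let \<open>f : P - h \<cong> P - l\<close>. Following \<open>l\<close> under \<open>f\<close> one reaches \<open>h\<close>, and
  this orbit is all of \<open>P\<close>. So \<open>P\<close> is isomorphic to \<open>{0..k}\<close> with \<open>i < j\<close> iff \<open>j - i \<in> D\<close>, for a set
  \<open>D\<close> of positive numbers that is closed under addition as far as sums are at most \<open>k\<close>; moreover
  \<open>D\<close> can be read off the down degrees. It remains to find a minmax pair of pseudo-similar points
  in every \<open>Q\<close> with the same deck. Such a \<open>Q\<close> has two points whose cards are isomorphic to the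
  restriction \<open>B\<close> of this order to \<open>{0..<k}\<close>. If \<open>P\<close> is not a chain, then \<open>Q\<close> has the same distributions of
  up and down degrees as \<open>P\<close> and the same number of chains of three elements; as the two degrees
  are ordered oppositely in \<open>P\<close>, they are so in \<open>Q\<close>. This rules out that one of the two points is
  neither minimal nor maximal, as all elements of \<open>D\<close> would be multiples of one of them. If both
  points were minimal (or, dually, both maximal), the displacement between the two ways of
  identifying a card of \<open>Q\<close> with \<open>B\<close> would be a harmonic function on the remaining points,
  positive above the one point and negative above the other one, so \<open>Q\<close> would be disconnected.
\<close>

section \<open>Isomorphic cards and Kelly's lemma\<close>

text \<open>The carriers are explicit, so that subsets and cards can be compared without first
  restricting the relations.\<close>

definition iso_on :: "'a rel \<Rightarrow> 'a set \<Rightarrow> 'b rel \<Rightarrow> 'b set \<Rightarrow> bool" where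
  "iso_on r A s B \<longleftrightarrow> (\<exists>f. bij_betw f A B \<and> (\<forall>x\<in>A. \<forall>y\<in>A. (x, y) \<in> r \<longleftrightarrow> (f x, f y) \<in> s))"

lemma iso_onI:
  assumes "bij_betw f A B"
    "\<And>x y. x \<in> A \<Longrightarrow> y \<in> A \<Longrightarrow> (x, y) \<in> r \<longleftrightarrow> (f x, f y) \<in> s"
  shows "iso_on r A s B"
  using assms unfolding iso_on_def by blast

lemma iso_on_sym:
  assumes "iso_on r A s B" shows "iso_on s B r A"
proof -
  obtain f where f: "bij_betw f A B" and o:
    "\<And>x y. x \<in> A \<Longrightarrow> y \<in> A \<Longrightarrow> (x, y) \<in> r \<longleftrightarrow> (f x, f y) \<in> s"
    using assms unfolding iso_on_def by blast
  show ?thesis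
  proof (rule iso_onI)
    show g: "bij_betw (inv_into A f) B A" using f by (rule bij_betw_inv_into)
    fix x y assume "x \<in> B" "y \<in> B"
    then show "(x, y) \<in> s \<longleftrightarrow> (inv_into A f x, inv_into A f y) \<in> r"
      using o bij_betw_inv_into_right[OF f] bij_betwE[OF g] by auto
  qed
qed

lemma iso_on_trans:
  assumes "iso_on r A s B" "iso_on s B t C" shows "iso_on r A t C"
proof -
  obtain f g where f: "bij_betw f A B" and g: "bij_betw g B C"
    and of: "\<And>x y. x \<in> A \<Longrightarrow> y \<in> A \<Longrightarrow> (x, y) \<in> r \<longleftrightarrow> (f x, f y) \<in> s"
    and og: "\<And>x y. x \<in> B \<Longrightarrow> y \<in> B \<Longrightarrow> (x, y) \<in> s \<longleftrightarrow> (g x, g y) \<in> t"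
    using assms unfolding iso_on_def by blast
  show ?thesis
    by (rule iso_onI[of "g \<circ> f"]) (use f g of og bij_betwE[OF f] in \<open>auto intro: bij_betw_trans\<close>)
qed

lemma iso_on_card: "iso_on r A s B \<Longrightarrow> card A = card B"
  unfolding iso_on_def using bij_betw_same_card by blast

lemma iso_on_converse: "iso_on r A s B \<Longrightarrow> iso_on (r\<inverse>) A (s\<inverse>) B"
  unfolding iso_on_def by (metis converse_iff)

lemma iso_on_image:
  assumes "bij_betw f A B"
    "\<And>x y. x \<in> A \<Longrightarrow> y \<in> A \<Longrightarrow> (x, y) \<in> r \<longleftrightarrow> (f x, f y) \<in> s" "X \<subseteq> A"
  shows "iso_on r X s (f ` X)"
proof (rule iso_onI)
  show "bij_betw f X (f ` X)" using assms(1,3) by (rule bij_betw_subset) simp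
qed (use assms in blast)

text \<open>Patterns on \<open>nat\<close> can be looked for in two orders that live on different
  types.\<close>

lemma iso_on_nat_copy:
  assumes "finite A"
  obtains R :: "nat rel" and C :: "nat set" where "finite C" "iso_on r A R C"
proof -
  obtain f :: "'a \<Rightarrow> nat" where inj: "inj_on f A"
    using finite_imp_inj_to_nat_seg[OF assms] by blast
  let ?R = "{(f x, f y) | x y. x \<in> A \<and> y \<in> A \<and> (x, y) \<in> r}"
  have "iso_on r A ?R (f ` A)"
  proof (rule iso_onI)
    show "bij_betw f A (f ` A)" using inj by (simp add: bij_betw_def)
    fix x y assume "x \<in> A" "y \<in> A"
    then show "(x, y) \<in> r \<longleftrightarrow> (f x, f y) \<in> ?R" using inj
      by (auto simp: inj_on_eq_iff)
  qed
  then show ?thesis using that assms by blast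
qed

section \<open>Equal decks as bijections that match isomorphic cards\<close>

lemma isomorphic_iff_iso_on: "isomorphic P Q \<longleftrightarrow> iso_on P (Field P) Q (Field Q)"
  unfolding isomorphic_def iso_on_def iso_iff2 by blast

lemma Field_delete_point:
  assumes "Refl P" shows "Field (delete_point P x) = Field P - {x}"
  using assms unfolding delete_point_def Field_def refl_on_def by blast

lemma isomorphic_delete_point_iff:
  assumes "Refl P" "Refl Q"
  shows "isomorphic (delete_point P x) (delete_point Q y) \<longleftrightarrow>
    iso_on P (Field P - {x}) Q (Field Q - {y})"
proof -
  have "bij_betw f (Field P - {x}) (Field Q - {y}) \<Longrightarrow>
      (\<forall>a\<in>Field P - {x}. \<forall>b\<in>Field P - {x}.
        (a, b) \<in> delete_point P x \<longleftrightarrow> (f a, f b) \<in> delete_point Q y) \<longleftrightarrow>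
      (\<forall>a\<in>Field P - {x}. \<forall>b\<in>Field P - {x}. (a, b) \<in> P \<longleftrightarrow> (f a, f b) \<in> Q)" for f
    unfolding delete_point_def using bij_betwE[of f "Field P - {x}" "Field Q - {y}"] by simp
  then show ?thesis
    unfolding isomorphic_iff_iso_on Field_delete_point[OF assms(1)] Field_delete_point[OF assms(2)]
      iso_on_def by blast
qed

lemma Partial_order_delete_point:
  assumes "Partial_order P" shows "Partial_order (delete_point P x)"
proof -
  have "Refl P" using assms by (simp add: order_on_defs)
  have "refl_on (Field P - {x}) (delete_point P x)"
    using \<open>Refl P\<close> unfolding delete_point_def refl_on_def by blast
  moreover have "trans (delete_point P x)" "antisym (delete_point P x)"
    using assms unfolding delete_point_def order_on_defs
      by (auto intro: trans_Restr simp: antisym_def)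
  ultimately show ?thesis
    unfolding order_on_defs Field_delete_point[OF \<open>Refl P\<close>]
    by (auto simp: delete_point_def)
qed

text \<open>The bijection is built point by point: \<open>a\<close> is matched with any
  \<open>b\<close> of the same value, which then cancels from both multisets.\<close>

lemma image_mset_eq_imp_bij_betw:
  assumes "finite A" "finite B" "image_mset f (mset_set A) = image_mset g (mset_set B)"
  shows "\<exists>h. bij_betw h A B \<and> (\<forall>a\<in>A. f a = g (h a))"
  using assms
proof (induction A arbitrary: B rule: finite_induct)
  case empty
  then have "B = {}"
    by (metis image_mset_empty image_mset_is_empty_iff mset_set.empty mset_set_empty_iff)
  then show ?case by (simp add: bij_betw_def)
next
  case (insert a A)
  have "f a \<in># image_mset g (mset_set B)" using insert.hyps by (simp flip: insert.prems(2))
  then obtain b where b: "b \<in> B" "f a = g b" using insert.prems(1) by auto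
  have "mset_set B = add_mset b (mset_set (B - {b}))"
    using b(1) insert.prems(1) by (metis mset_set.remove)
  then have "image_mset f (mset_set A) = image_mset g (mset_set (B - {b}))"
    using insert b by simp
  then obtain h where h: "bij_betw h A (B - {b})" "\<forall>a\<in>A. f a = g (h a)"
    using insert.IH[of "B - {b}"] insert.prems(1) by auto
  have "bij_betw (h(a := b)) (insert a A) (insert b (B - {b}))"
  proof (rule bij_betw_imageI)
    have "h x \<noteq> b" if "x \<in> A" for x using bij_betwE[OF h(1)] that by blast
    then show "inj_on (h(a := b)) (insert a A)"
      using h(1) insert.hyps(2) by (auto simp: bij_betw_def inj_on_def)
    have "(h(a := b)) ` A = h ` A" using insert.hyps(2) by (intro image_cong) auto
    also have "\<dots> = B - {b}" using h(1) by (simp add: bij_betw_def)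
    finally show "(h(a := b)) ` insert a A = insert b (B - {b})"
      by (simp only: image_insert fun_upd_same)
  qed
  moreover have "insert b (B - {b}) = B" using b by blast
  moreover have "\<forall>x\<in>insert a A. f x = g ((h(a := b)) x)" using h(2) b(2) insert.hyps(2)
    by auto
  ultimately show ?case by metis
qed

lemma deck_eq_imp_bij_betw:
  assumes P: "Partial_order P" "finite (Field P)" "Field P \<noteq> {}"
    and Q: "Partial_order Q" and eq: "deck Q = deck P"
  shows "finite (Field Q)"
    and "\<exists>h. bij_betw h (Field P) (Field Q) \<and>
      (\<forall>x\<in>Field P. iso_on P (Field P - {x}) Q (Field Q - {h x}))"
proof -
  \<comment> \<open>The deck of an infinite order is empty by the default value of
    \<open>mset_set\<close>; a nonempty deck therefore forces \<open>Field Q\<close> to be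
    finite.\<close>
  have "deck P \<noteq> {#}" using P by (simp add: deck_def mset_set_empty_iff)
  then show fin: "finite (Field Q)"
    using eq by (metis deck_def image_mset_empty mset_set.infinite)
  have refl: "Refl P" "Refl Q" using P Q by (auto simp: order_on_defs)
  obtain h where h: "bij_betw h (Field P) (Field Q)"
    "\<forall>x\<in>Field P. iso_type (delete_point P x) = iso_type (delete_point Q (h x))"
    using image_mset_eq_imp_bij_betw[OF P(2) fin] eq unfolding deck_def by metis
  have "iso_on P (Field P - {x}) Q (Field Q - {h x})" if "x \<in> Field P" for x
  proof -
    have "finite (Field (delete_point P x))" using P(2)
      by (simp add: Field_delete_point[OF refl(1)])
    then show ?thesis
      using iso_type_eq_iff[OF Partial_order_delete_point[OF P(1)]] h(2) that
        isomorphic_delete_point_iff[OF refl] by blast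
  qed
  with h(1) show "\<exists>h. bij_betw h (Field P) (Field Q) \<and>
      (\<forall>x\<in>Field P. iso_on P (Field P - {x}) Q (Field Q - {h x}))" by blast
qed

section \<open>Kelly's counting argument\<close>

definition same_cards :: "'a rel \<Rightarrow> 'a set \<Rightarrow> 'b rel \<Rightarrow> 'b set \<Rightarrow> bool" where
  "same_cards r A s B \<longleftrightarrow>
    (\<exists>h. bij_betw h A B \<and> (\<forall>x\<in>A. iso_on r (A - {x}) s (B - {h x})))"

lemma same_cards_sym:
  assumes "same_cards r A s B" shows "same_cards s B r A"
proof -
  obtain h where h: "bij_betw h A B"
    "\<And>x. x \<in> A \<Longrightarrow> iso_on r (A - {x}) s (B - {h x})"
    using assms unfolding same_cards_def by blast
  have g: "bij_betw (inv_into A h) B A" using h(1) by (rule bij_betw_inv_into)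
  have "iso_on s (B - {y}) r (A - {inv_into A h y})" if "y \<in> B" for y
    using h(2)[of "inv_into A h y"] bij_betwE[OF g] that bij_betw_inv_into_right[OF h(1)]
    by (metis iso_on_sym)
  with g show ?thesis unfolding same_cards_def by blast
qed

lemma same_cards_converse: "same_cards r A s B \<Longrightarrow> same_cards (r\<inverse>) A (s\<inverse>) B"
  unfolding same_cards_def using iso_on_converse by blast

lemma same_cards_card: "same_cards r A s B \<Longrightarrow> card A = card B"
  unfolding same_cards_def using bij_betw_same_card by blast

text \<open>Each \<open>m\<close>-subset avoids exactly \<open>card A - m\<close> points, so it is
  counted in that many cards.\<close>

lemma sum_subsets_delete:
  fixes w :: "'a set \<Rightarrow> nat"
  assumes "finite A"
  shows "(\<Sum>x\<in>A. \<Sum>X | X \<subseteq> A - {x} \<and> card X = m. w X) =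
    (card A - m) * (\<Sum>X | X \<subseteq> A \<and> card X = m. w X)"
proof -
  let ?S = "{X. X \<subseteq> A \<and> card X = m}"
  have fin: "finite ?S" using assms by simp
  have "(\<Sum>x\<in>A. \<Sum>X | X \<subseteq> A - {x} \<and> card X = m. w X) = (\<Sum>x\<in>A. \<Sum>X | X \<in> ?S \<and> x \<notin> X. w X)"
    by (intro sum.cong refl) auto
  also have "\<dots> = (\<Sum>X\<in>?S. \<Sum>x | x \<in> A \<and> x \<notin> X. w X)"
    by (rule sum.swap_restrict[OF assms fin])
  also have "\<dots> = (\<Sum>X\<in>?S. (card A - m) * w X)"
  proof (rule sum.cong[OF refl])
    fix X assume "X \<in> ?S"
    then have "card (A - X) = card A - m" using assms by (auto simp: card_Diff_subset finite_subset)
    moreover have "{x. x \<in> A \<and> x \<notin> X} = A - X" by blast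
    ultimately show "(\<Sum>x | x \<in> A \<and> x \<notin> X. w X) = (card A - m) * w X" by simp
  qed
  finally show ?thesis by (simp add: sum_distrib_left)
qed

text \<open>Summed over all cards, the totals give the total over the whole structure times
  \<open>card A - m\<close>, a factor that is positive and cancels. General weights cover copies of
  a pattern, greatest elements and chains alike.\<close>

lemma kelly:
  fixes v :: "'a set \<Rightarrow> nat" and w :: "'b set \<Rightarrow> nat"
  assumes sc: "same_cards r A s B" and fin: "finite A" and m: "m < card A"
    and eq: "\<And>X Y. X \<subseteq> A \<Longrightarrow> Y \<subseteq> B \<Longrightarrow> card X = m \<Longrightarrow> iso_on r X s Y \<Longrightarrow> v X = w Y"
  shows "(\<Sum>X | X \<subseteq> A \<and> card X = m. v X) = (\<Sum>Y | Y \<subseteq> B \<and> card Y = m. w Y)"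
proof -
  obtain h where h: "bij_betw h A B"
    "\<And>x. x \<in> A \<Longrightarrow> iso_on r (A - {x}) s (B - {h x})"
    using sc unfolding same_cards_def by blast
  have finB: "finite B" and card: "card A = card B"
    using h(1) fin bij_betw_finite bij_betw_same_card by blast+
  have card_eq:
    "(\<Sum>X | X \<subseteq> A - {x} \<and> card X = m. v X) = (\<Sum>Y | Y \<subseteq> B - {h x} \<and> card Y = m. w Y)"
    if x: "x \<in> A" for x
  proof -
    obtain f where f: "bij_betw f (A - {x}) (B - {h x})"
      and o: "\<And>a b. a \<in> A - {x} \<Longrightarrow> b \<in> A - {x} \<Longrightarrow> (a, b) \<in> r \<longleftrightarrow> (f a, f b) \<in> s"
      using h(2)[OF x] unfolding iso_on_def by blast
    let ?S = "{X. X \<subseteq> A - {x} \<and> card X = m}" and ?T = "{Y. Y \<subseteq> B - {h x} \<and> card Y = m}"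
    have inj: "inj_on f (A - {x})" using f by (simp add: bij_betw_def)
    \<comment> \<open>An isomorphism of two cards induces a bijection of their
      \<open>m\<close>-subsets, so the totals agree card by card.\<close>
    have im: "bij_betw ((`) f) (Pow (A - {x})) (Pow (B - {h x}))" using f by (rule bij_betw_Pow)
    have "bij_betw ((`) f) ?S ?T"
    proof (rule bij_betw_subset[OF im])
      have c: "card (f ` X) = card X" if "X \<subseteq> A - {x}" for X
        using card_image[OF inj_on_subset[OF inj that]] .
      show "(`) f ` ?S = ?T"
      proof
        show "(`) f ` ?S \<subseteq> ?T" using bij_betwE[OF im] c by (auto simp: subset_iff)
        show "?T \<subseteq> (`) f ` ?S"
        proof
          fix Y assume Y: "Y \<in> ?T"
          then have "Y \<in> (`) f ` Pow (A - {x})" using im by (simp add: bij_betw_def)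
          then obtain X where "Y = f ` X" "X \<subseteq> A - {x}" by blast
          then show "Y \<in> (`) f ` ?S" using Y c by auto
        qed
      qed
    qed blast
    then have "(\<Sum>X\<in>?S. w (f ` X)) = (\<Sum>Y\<in>?T. w Y)" by (rule sum.reindex_bij_betw)
    moreover have "v X = w (f ` X)" if X: "X \<in> ?S" for X
    proof -
      have "iso_on r X s (f ` X)" using iso_on_image[OF f o] X by blast
      moreover have "f ` X \<subseteq> B" using X f by (auto simp: bij_betw_def)
      ultimately show ?thesis using X by (intro eq) auto
    qed
    ultimately show ?thesis by simp
  qed
  have "(card A - m) * (\<Sum>X | X \<subseteq> A \<and> card X = m. v X) =
      (\<Sum>x\<in>A. \<Sum>Y | Y \<subseteq> B - {h x} \<and> card Y = m. w Y)"
    using card_eq by (simp add: sum_subsets_delete[OF fin, symmetric])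
  also have "\<dots> = (\<Sum>y\<in>B. \<Sum>Y | Y \<subseteq> B - {y} \<and> card Y = m. w Y)"
    by (rule sum.reindex_bij_betw[OF h(1)])
  also have "\<dots> = (card A - m) * (\<Sum>Y | Y \<subseteq> B \<and> card Y = m. w Y)"
    using sum_subsets_delete[OF finB] card by simp
  finally show ?thesis using m by simp
qed

section \<open>Connected relations\<close>

definition separated :: "'a rel \<Rightarrow> 'a set \<Rightarrow> 'a set \<Rightarrow> bool" where
  "separated r X Y \<longleftrightarrow> (\<forall>x\<in>X. \<forall>y\<in>Y. (x, y) \<notin> r \<and> (y, x) \<notin> r)"

text \<open>Connectedness of the comparability graph, expressed by cuts instead of paths; the empty
  set is not connected.\<close>

definition connected_on :: "'a rel \<Rightarrow> 'a set \<Rightarrow> bool" where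
  "connected_on r A \<longleftrightarrow> A \<noteq> {} \<and> (\<forall>X\<subseteq>A. X \<noteq> {} \<longrightarrow> separated r X (A - X) \<longrightarrow> X = A)"

lemma separated_mono: "separated r X Y \<Longrightarrow> X' \<subseteq> X \<Longrightarrow> Y' \<subseteq> Y \<Longrightarrow> separated r X' Y'"
  unfolding separated_def by blast

lemma connected_onD:
  "connected_on r A \<Longrightarrow> X \<subseteq> A \<Longrightarrow> X \<noteq> {} \<Longrightarrow> separated r X (A - X) \<Longrightarrow> X = A"
  unfolding connected_on_def by blast

lemma connected_on_nonempty: "connected_on r A \<Longrightarrow> A \<noteq> {}"
  unfolding connected_on_def by blast

lemma connected_on_singleton: "connected_on r {a}"
  unfolding connected_on_def by blast

lemma connected_on_converse: "connected_on (r\<inverse>) A \<longleftrightarrow> connected_on r A"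
  unfolding connected_on_def separated_def by simp blast

lemma connected_on_insert:
  assumes "connected_on r X" "x \<in> X" "(x, y) \<in> r \<or> (y, x) \<in> r"
  shows "connected_on r (insert y X)"
  unfolding connected_on_def
proof (intro conjI allI impI)
  fix S assume S: "S \<subseteq> insert y X" "S \<noteq> {}" "separated r S (insert y X - S)"
  have "S \<inter> X \<noteq> {}"
  proof
    assume "S \<inter> X = {}"
    with S assms(2) have "y \<in> S" "x \<in> insert y X - S" by auto
    with S(3) assms(3) show False unfolding separated_def by blast
  qed
  moreover have "separated r (S \<inter> X) (X - S \<inter> X)"
    using S(3) by (rule separated_mono) blast+
  ultimately have "S \<inter> X = X" using connected_onD[OF assms(1)] by blast
  then have "X \<subseteq> S" by blast
  moreover have "y \<in> S"
    using \<open>X \<subseteq> S\<close> S(3) assms(2,3) unfolding separated_def by blast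
  ultimately show "S = insert y X" using S(1) by blast
qed simp

lemma connected_on_subset_separated:
  assumes "connected_on r X" "X \<subseteq> A" "T \<subseteq> A" "separated r T (A - T)"
  shows "X \<subseteq> T \<or> X \<subseteq> A - T"
proof (cases "X \<inter> T = {}")
  case False
  have "separated r (X \<inter> T) (X - X \<inter> T)" using assms(4)
    by (rule separated_mono) (use assms in blast)+
  then have "X \<inter> T = X" using connected_onD[OF assms(1)] False by blast
  then show ?thesis by blast
qed (use assms in blast)

lemma iso_on_connected_on:
  assumes "iso_on r A s B" "connected_on r A" shows "connected_on s B"
proof -
  obtain f where f: "bij_betw f A B" and o:
    "\<And>x y. x \<in> A \<Longrightarrow> y \<in> A \<Longrightarrow> (x, y) \<in> r \<longleftrightarrow> (f x, f y) \<in> s"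
    using assms(1) unfolding iso_on_def by blast
  show ?thesis unfolding connected_on_def
  proof (intro conjI allI impI)
    show "B \<noteq> {}" using f connected_on_nonempty[OF assms(2)] by (auto simp: bij_betw_def)
    fix Y assume Y: "Y \<subseteq> B" "Y \<noteq> {}" "separated s Y (B - Y)"
    let ?X = "{x \<in> A. f x \<in> Y}"
    have im: "f ` A = B" using f by (simp add: bij_betw_def)
    have "?X \<noteq> {}" using Y(1,2) im by blast
    moreover have "separated r ?X (A - ?X)" unfolding separated_def
    proof (intro ballI)
      fix x y assume xy: "x \<in> ?X" "y \<in> A - ?X"
      then have "f x \<in> Y" "f y \<in> B - Y" using im by auto
      then show "(x, y) \<notin> r \<and> (y, x) \<notin> r" using Y(3) o xy
        by (simp add: separated_def)
    qed
    ultimately have "?X = A" by (intro connected_onD[OF assms(2)]) auto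
    then show "Y = B" using im Y(1) by blast
  qed
qed

lemma obtain_max_card:
  assumes "finite \<C>" "\<C> \<noteq> {}"
  obtains X where "X \<in> \<C>" "\<And>Y. Y \<in> \<C> \<Longrightarrow> card Y \<le> card X"
proof -
  have "Max (card ` \<C>) \<in> card ` \<C>" using assms by simp
  then obtain X where "X \<in> \<C>" "Max (card ` \<C>) = card X" by blast
  moreover have "card Y \<le> Max (card ` \<C>)" if "Y \<in> \<C>" for Y using assms(1) that by simp
  ultimately show ?thesis using that by auto
qed

text \<open>A largest connected proper subset containing \<open>a\<close> has a neighbour outside;
  adding it gives everything, so exactly one point was missing. Two uses of this give two connected
  cards.\<close>

lemma connected_on_delete_point:
  assumes con: "connected_on r A" and fin: "finite A" and a: "a \<in> A" and card: "card A \<ge> 2"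
  shows "\<exists>y\<in>A - {a}. connected_on r (A - {y})"
proof -
  let ?C = "{X. X \<subseteq> A \<and> a \<in> X \<and> X \<noteq> A \<and> connected_on r X}"
  have "A \<noteq> {a}" using card by auto
  then have "{a} \<in> ?C" using a connected_on_singleton[of r a] by auto
  then have ne: "?C \<noteq> {}" by blast
  have "finite ?C" using fin by simp
  then obtain X where X: "X \<in> ?C" "\<And>Y. Y \<in> ?C \<Longrightarrow> card Y \<le> card X"
    using obtain_max_card[OF _ ne] by blast
  have "\<not> separated r X (A - X)" using X(1) connected_onD[OF con, of X] by blast
  then obtain x y where xy: "x \<in> X" "y \<in> A - X" "(x, y) \<in> r \<or> (y, x) \<in> r"
    unfolding separated_def by blast
  have "connected_on r (insert y X)" using X(1) xy by (blast intro: connected_on_insert)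
  moreover have "card (insert y X) > card X" using X(1) xy(2) fin by (auto simp: finite_subset)
  ultimately have "insert y X \<notin> ?C" using X(2) by (meson leD)
  then have "insert y X = A" using X(1) xy(2) \<open>connected_on r (insert y X)\<close> by blast
  then have "A - {y} = X" using xy(2) by blast
  then show ?thesis using X(1) xy(2) by auto
qed

text \<open>A cut would have each of the connected sets \<open>A - {x}\<close> and
  \<open>A - {y}\<close> on one side, so its sides would be \<open>{x}\<close> and
  \<open>{y}\<close>, leaving no third point.\<close>

lemma not_connected_on_two_cards:
  assumes "connected_on r (A - {x})" "connected_on r (A - {y})" "x \<in> A" "y \<in> A"
    "x \<noteq> y"
    and "card A \<ge> 3"
  shows "connected_on r A"
proof (rule ccontr)
  assume "\<not> connected_on r A"
  then obtain T where T: "T \<subseteq> A" "T \<noteq> {}" "T \<noteq> A" "separated r T (A - T)"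
    using assms(3) unfolding connected_on_def by blast
  have "A - {x} \<subseteq> T \<or> A - {x} \<subseteq> A - T"
    "A - {y} \<subseteq> T \<or> A - {y} \<subseteq> A - T"
    using connected_on_subset_separated[OF _ Diff_subset T(1,4)] assms(1,2) by blast+
  then have "A \<subseteq> {x, y}" using T assms(5) by blast
  then have "card A \<le> card {x, y}" by (intro card_mono) auto
  then show False using assms(5,6) by simp
qed

lemma same_cards_connected_on:
  assumes sc: "same_cards r A s B" and fin: "finite A" and card: "card A \<ge> 3"
    and con: "connected_on r A"
  shows "connected_on s B"
proof -
  obtain h where h: "bij_betw h A B"
    "\<And>x. x \<in> A \<Longrightarrow> iso_on r (A - {x}) s (B - {h x})"
    using sc unfolding same_cards_def by blast
  obtain x where x: "x \<in> A" "connected_on r (A - {x})"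
    using connected_on_delete_point[OF con fin] connected_on_nonempty[OF con] card by fastforce
  obtain y where y: "y \<in> A - {x}" "connected_on r (A - {y})"
    using connected_on_delete_point[OF con fin x(1)] card by auto
  show ?thesis
  proof (rule not_connected_on_two_cards)
    show "connected_on s (B - {h x})" "connected_on s (B - {h y})"
      using h(2) x y iso_on_connected_on by blast+
    show "h x \<in> B" "h y \<in> B" using bij_betwE[OF h(1)] x y by blast+
    show "h x \<noteq> h y" using h(1) x y by (auto simp: bij_betw_def inj_on_eq_iff)
    show "card B \<ge> 3" using bij_betw_same_card[OF h(1)] card by simp
  qed
qed

section \<open>Reconstruction of disconnected orders\<close>

lemma card_copies_separated:
  assumes fin: "finite A" and T: "T \<subseteq> A" "separated r T (A - T)" and con:
    "connected_on R C"
  shows "card {X. X \<subseteq> A \<and> iso_on r X R C} =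
    card {X. X \<subseteq> T \<and> iso_on r X R C} + card {X. X \<subseteq> A - T \<and> iso_on r X R C}"
proof -
  have con': "connected_on r X" if "iso_on r X R C" for X
    using iso_on_connected_on[OF iso_on_sym[OF that] con] .
  \<comment> \<open>A connected copy cannot cross the cut, and being nonempty it does not lie on
    both sides.\<close>
  have "{X. X \<subseteq> A \<and> iso_on r X R C} =
      {X. X \<subseteq> T \<and> iso_on r X R C} \<union> {X. X \<subseteq> A - T \<and> iso_on r X R C}"
    using T con' connected_on_subset_separated[of r _ A T] by blast
  moreover have
    "{X. X \<subseteq> T \<and> iso_on r X R C} \<inter> {X. X \<subseteq> A - T \<and> iso_on r X R C} = {}"
    using connected_on_nonempty[OF con'] by blast
  moreover have "finite {X. X \<subseteq> T \<and> iso_on r X R C}"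
    "finite {X. X \<subseteq> A - T \<and> iso_on r X R C}"
    using fin T(1) by (auto simp: finite_subset)
  ultimately show ?thesis by (simp add: card_Un_disjoint)
qed

lemma card_copies_iso_on:
  assumes "iso_on r A s B"
  shows "card {X. X \<subseteq> A \<and> iso_on r X R C} = card {Y. Y \<subseteq> B \<and> iso_on s Y R C}"
proof -
  obtain f where f: "bij_betw f A B" and o:
    "\<And>x y. x \<in> A \<Longrightarrow> y \<in> A \<Longrightarrow> (x, y) \<in> r \<longleftrightarrow> (f x, f y) \<in> s"
    using assms unfolding iso_on_def by blast
  have im: "bij_betw ((`) f) (Pow A) (Pow B)" using f by (rule bij_betw_Pow)
  have iff: "iso_on s (f ` X) R C \<longleftrightarrow> iso_on r X R C" if "X \<subseteq> A" for X
  proof -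
    have "iso_on r X s (f ` X)" by (rule iso_on_image[OF f]) (use o that in auto)
    then show ?thesis using iso_on_trans[of r X s "f ` X" R C] iso_on_trans[of s "f ` X" r X R C]
      iso_on_sym[of r X s "f ` X"] by metis
  qed
  have "bij_betw ((`) f) {X. X \<subseteq> A \<and> iso_on r X R C} {Y. Y \<subseteq> B \<and> iso_on s Y R C}"
  proof (rule bij_betw_subset[OF im])
    show "(`) f ` {X. X \<subseteq> A \<and> iso_on r X R C} = {Y. Y \<subseteq> B \<and> iso_on s Y R C}"
    proof
      show "(`) f ` {X. X \<subseteq> A \<and> iso_on r X R C} \<subseteq> {Y. Y \<subseteq> B \<and> iso_on s Y R C}"
        using f iff by (auto simp: bij_betw_def)
      show "{Y. Y \<subseteq> B \<and> iso_on s Y R C} \<subseteq> (`) f ` {X. X \<subseteq> A \<and> iso_on r X R C}"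
      proof
        fix Y assume Y: "Y \<in> {Y. Y \<subseteq> B \<and> iso_on s Y R C}"
        then have "Y \<in> (`) f ` Pow A" using im by (simp add: bij_betw_def)
        then show "Y \<in> (`) f ` {X. X \<subseteq> A \<and> iso_on r X R C}" using Y iff by blast
      qed
    qed
  qed blast
  then show ?thesis by (rule bij_betw_same_card)
qed

lemma iso_on_Un_separated:
  assumes "iso_on r A s B" "iso_on r A' s B'" "A \<inter> A' = {}" "B \<inter> B' = {}"
    and "separated r A A'" "separated s B B'"
  shows "iso_on r (A \<union> A') s (B \<union> B')"
proof -
  obtain f where f: "bij_betw f A B" and of:
    "\<And>x y. x \<in> A \<Longrightarrow> y \<in> A \<Longrightarrow> (x, y) \<in> r \<longleftrightarrow> (f x, f y) \<in> s"
    using assms(1) unfolding iso_on_def by blast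
  obtain g where g: "bij_betw g A' B'" and og:
    "\<And>x y. x \<in> A' \<Longrightarrow> y \<in> A' \<Longrightarrow> (x, y) \<in> r \<longleftrightarrow> (g x, g y) \<in> s"
    using assms(2) unfolding iso_on_def by blast
  let ?h = "\<lambda>x. if x \<in> A then f x else g x"
  have hA: "?h x = f x" if "x \<in> A" for x using that by simp
  have hA': "?h x = g x" if "x \<in> A'" for x using that assms(3) by auto
  show ?thesis
  proof (rule iso_onI)
    have "bij_betw ?h A B" using f by (rule bij_betw_cong[THEN iffD1, rotated]) simp
    moreover have "bij_betw ?h A' B'" using g
      by (rule bij_betw_cong[THEN iffD1, rotated]) (simp add: hA')
    ultimately show "bij_betw ?h (A \<union> A') (B \<union> B')" using assms(4)
      by (rule bij_betw_combine)
    fix x y assume "x \<in> A \<union> A'" "y \<in> A \<union> A'"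
    then consider "x \<in> A" "y \<in> A" | "x \<in> A'" "y \<in> A'" | "x \<in> A" "y \<in> A'" |
      "x \<in> A'" "y \<in> A" by blast
    then show "(x, y) \<in> r \<longleftrightarrow> (?h x, ?h y) \<in> s"
    proof cases
      case 1 then show ?thesis using of hA by simp
    next
      case 2 then show ?thesis using og hA' by simp
    next
      case 3
      have "(x, y) \<notin> r" "(f x, g y) \<notin> s"
        using assms(5,6) 3 bij_betwE[OF f] bij_betwE[OF g] unfolding separated_def by blast+
      then show ?thesis using 3 hA hA' by simp
    next
      case 4
      have "(x, y) \<notin> r" "(g x, f y) \<notin> s"
        using assms(5,6) 4 bij_betwE[OF f] bij_betwE[OF g] unfolding separated_def by blast+
      then show ?thesis using 4 hA hA' by simp
    qed
  qed
qed

text \<open>A component of largest size is split off on each side; the two are isomorphic, so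
  subtracting their copies keeps the counts equal and the induction continues with the
  rests.\<close>

lemma iso_on_if_connected_copies_eq:
  assumes "finite A" "finite B"
    and "\<And>(R :: nat rel) C. finite C \<Longrightarrow> connected_on R C \<Longrightarrow>
      card {X. X \<subseteq> A \<and> iso_on r X R C} = card {Y. Y \<subseteq> B \<and> iso_on s Y R C}"
  shows "iso_on r A s B"
  using assms
proof (induction "card A" arbitrary: A B rule: less_induct)
  case less
  \<comment> \<open>A pattern with a copy in \<open>A\<close> has a copy in \<open>B\<close>, so
    every connected subset of \<open>A\<close> reappears in \<open>B\<close>;
    \<open>transfer'\<close> is the converse.\<close>
  have transfer: "\<exists>Y\<subseteq>B. iso_on r X s Y"
    if "X \<subseteq> A" "connected_on r X" for X
  proof -
    have "finite X" using that(1) less.prems(1) by (rule finite_subset)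
    then obtain R :: "nat rel" and C where C: "finite C" "iso_on r X R C"
      by (rule iso_on_nat_copy)
    have "X \<in> {X. X \<subseteq> A \<and> iso_on r X R C}" using that C by blast
    moreover have "finite {X. X \<subseteq> A \<and> iso_on r X R C}" using less.prems(1) by simp
    ultimately have "card {X. X \<subseteq> A \<and> iso_on r X R C} \<noteq> 0"
      unfolding card_eq_0_iff by blast
    then have "{Y. Y \<subseteq> B \<and> iso_on s Y R C} \<noteq> {}"
      using less.prems(3)[OF C(1) iso_on_connected_on[OF C(2) that(2)]] by (intro notI) simp
    then obtain Y where Y: "Y \<subseteq> B" "iso_on s Y R C" by blast
    have "iso_on r X s Y" using C(2) iso_on_sym[OF Y(2)] by (rule iso_on_trans)
    with Y(1) show ?thesis by blast
  qed
  have transfer': "\<exists>X\<subseteq>A. iso_on s Y r X"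
    if "Y \<subseteq> B" "connected_on s Y" for Y
  proof -
    have "finite Y" using that(1) less.prems(2) by (rule finite_subset)
    then obtain R :: "nat rel" and C where C: "finite C" "iso_on s Y R C"
      by (rule iso_on_nat_copy)
    have "Y \<in> {X. X \<subseteq> B \<and> iso_on s X R C}" using that C by blast
    moreover have "finite {X. X \<subseteq> B \<and> iso_on s X R C}" using less.prems(2) by simp
    ultimately have "card {X. X \<subseteq> B \<and> iso_on s X R C} \<noteq> 0"
      unfolding card_eq_0_iff by blast
    then have "{Y. Y \<subseteq> A \<and> iso_on r Y R C} \<noteq> {}"
      using less.prems(3)[OF C(1) iso_on_connected_on[OF C(2) that(2)]] by (intro notI) simp
    then obtain X where X: "X \<subseteq> A" "iso_on r X R C" by blast
    have "iso_on s Y r X" using C(2) iso_on_sym[OF X(2)] by (rule iso_on_trans)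
    with X(1) show ?thesis by blast
  qed
  show ?case
  proof (cases "A = {}")
    case True
    have "B = {}"
    proof (rule ccontr)
      assume "B \<noteq> {}"
      then obtain b where "b \<in> B" by blast
      then have "iso_on s {b} r {}" using transfer'[of "{b}"] True connected_on_singleton[of s b]
        by auto
      then show False using iso_on_card by fastforce
    qed
    then show ?thesis using True by (auto simp: iso_on_def bij_betw_def)
  next
    case False
    let ?C = "{X. X \<subseteq> A \<and> connected_on r X}"
    have fin: "finite ?C" using less.prems(1) by simp
    obtain a where "a \<in> A" using False by blast
    then have "{a} \<in> ?C" using connected_on_singleton[of r a] by simp
    then have "?C \<noteq> {}" by blast
    then obtain T where T: "T \<in> ?C" "\<And>X. X \<in> ?C \<Longrightarrow> card X \<le> card T"
      using obtain_max_card[OF fin] by blast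
    then obtain T' where T': "T' \<subseteq> B" "iso_on r T s T'" using transfer[of T] by blast
    have conT': "connected_on s T'" using T(1) iso_on_connected_on[OF T'(2)] by simp
    have finT: "finite T" "finite T'" using T(1) T'(1) less.prems finite_subset by blast+
    have sepT: "separated r T (A - T)"
    proof (rule ccontr)
      assume "\<not> separated r T (A - T)"
      then obtain x y where xy: "x \<in> T" "y \<in> A - T" "(x, y) \<in> r \<or> (y, x) \<in> r"
        unfolding separated_def by blast
      have "insert y T \<in> ?C" using T(1) xy(2) connected_on_insert[OF _ xy(1,3)] by auto
      then have "card (insert y T) \<le> card T" by (rule T(2))
      then show False using xy(2) finT by simp
    qed
    \<comment> \<open>If \<open>T'\<close> could be enlarged to a connected set, that set would
      reappear in \<open>A\<close> with more points than \<open>T\<close>.\<close>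
    have sepT': "separated s T' (B - T')"
    proof (rule ccontr)
      assume "\<not> separated s T' (B - T')"
      then obtain x y where xy: "x \<in> T'" "y \<in> B - T'" "(x, y) \<in> s \<or> (y, x) \<in> s"
        unfolding separated_def by blast
      have c: "connected_on s (insert y T')" using conT' xy(1,3) by (rule connected_on_insert)
      then obtain X where X: "X \<subseteq> A" "iso_on s (insert y T') r X"
        using transfer'[OF _ c] T'(1) xy(2) by auto
      have "card X \<le> card T" using T(2) X(1) iso_on_connected_on[OF X(2) c] by simp
      then show False
        using iso_on_card[OF X(2)] iso_on_card[OF T'(2)] xy(2) finT by simp
    qed
    have "T \<noteq> {}" using T(1) connected_on_nonempty[of r T] by simp
    then have "card (A - T) < card A" using T(1) less.prems(1) by (intro psubset_card_mono) auto
    then have "iso_on r (A - T) s (B - T')"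
    proof (rule less.hyps)
      fix R :: "nat rel" and C assume C: "finite C" "connected_on R C"
      show "card {X. X \<subseteq> A - T \<and> iso_on r X R C} = card {Y. Y \<subseteq> B - T' \<and> iso_on s Y R C}"
        using less.prems(3)[OF C] card_copies_separated[OF less.prems(1) _ sepT C(2)]
          card_copies_separated[OF less.prems(2) T'(1) sepT' C(2)]
            card_copies_iso_on[OF T'(2), of R C] T(1)
        by simp
    qed (use less.prems in auto)
    then have "iso_on r (T \<union> (A - T)) s (T' \<union> (B - T'))"
      using T'(2) sepT sepT' by (intro iso_on_Un_separated) auto
    moreover have "T \<union> (A - T) = A" "T' \<union> (B - T') = B" using T(1) T'(1) by blast+
    ultimately show ?thesis by simp
  qed
qed

lemma disconnected_reconstructible:
  assumes sc: "same_cards r A s B" and fin: "finite A" and card: "card A \<ge> 3"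
    and dis: "\<not> connected_on r A"
  shows "iso_on r A s B"
proof (rule iso_on_if_connected_copies_eq)
  have cardB: "card A = card B" using same_cards_card[OF sc] .
  show "finite A" by fact
  show finB: "finite B" using cardB card card.infinite by fastforce
  fix R :: "nat rel" and C assume C: "finite C" "connected_on R C"
  have disB: "\<not> connected_on s B"
    using same_cards_connected_on[OF same_cards_sym[OF sc] finB] dis card cardB by auto
  show "card {X. X \<subseteq> A \<and> iso_on r X R C} = card {Y. Y \<subseteq> B \<and> iso_on s Y R C}"
  \<comment> \<open>Kelly's lemma reaches only patterns smaller than \<open>A\<close>. A connected
    pattern of at least that size has no copy, because \<open>A\<close> and \<open>B\<close> are
    disconnected.\<close>
  proof (cases "card C < card A")
    case True
    let ?v = "\<lambda>X. if iso_on r X R C then 1 else 0 :: nat"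
    let ?w = "\<lambda>Y. if iso_on s Y R C then 1 else 0 :: nat"
    have "(\<Sum>X | X \<subseteq> A \<and> card X = card C. ?v X) = (\<Sum>Y | Y \<subseteq> B \<and> card Y = card C. ?w Y)"
      using sc fin True
    proof (rule kelly)
      fix X Y assume "iso_on r X s Y"
      then have "iso_on r X R C \<longleftrightarrow> iso_on s Y R C"
        using iso_on_trans[of r X s Y R C] iso_on_trans[of s Y r X R C] iso_on_sym[of r X s Y]
          by metis
      then show "?v X = ?w Y" by simp
    qed
    moreover have
      "{X. X \<subseteq> A \<and> iso_on r X R C} = {X \<in> {X. X \<subseteq> A \<and> card X = card C}. iso_on r X R C}"
      "{Y. Y \<subseteq> B \<and> iso_on s Y R C} = {Y \<in> {Y. Y \<subseteq> B \<and> card Y = card C}. iso_on s Y R C}"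
      using iso_on_card by blast+
    ultimately show ?thesis using fin finB by (simp add: sum.If_cases Int_def)
  next
    case False
    have "\<not> (X \<subseteq> A \<and> iso_on r X R C)" for X
      using False dis iso_on_connected_on[OF iso_on_sym C(2), of r X] iso_on_card[of r X R C] fin
      by (metis card_seteq leI)
    then have "{X. X \<subseteq> A \<and> iso_on r X R C} = {}" by blast
    moreover have "\<not> (Y \<subseteq> B \<and> iso_on s Y R C)" for Y
      using False disB iso_on_connected_on[OF iso_on_sym C(2), of s Y]
        iso_on_card[of s Y R C] finB cardB
      by (metis card_seteq leI)
    then have "{Y. Y \<subseteq> B \<and> iso_on s Y R C} = {}" by blast
    ultimately show ?thesis by (simp only: card.empty)
  qed
qed

section \<open>Degrees\<close>

definition lower :: "'a rel \<Rightarrow> 'a set \<Rightarrow> 'a \<Rightarrow> 'a set" where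
  "lower r A x = {y \<in> A. (y, x) \<in> r \<and> y \<noteq> x}"

definition upper :: "'a rel \<Rightarrow> 'a set \<Rightarrow> 'a \<Rightarrow> 'a set" where
  "upper r A x = {y \<in> A. (x, y) \<in> r \<and> y \<noteq> x}"

lemma lower_converse [simp]: "lower (r\<inverse>) A x = upper r A x"
  by (simp add: lower_def upper_def)

lemma upper_converse [simp]: "upper (r\<inverse>) A x = lower r A x"
  by (simp add: lower_def upper_def)

lemma lower_subset: "lower r A x \<subseteq> A" and upper_subset: "upper r A x \<subseteq> A"
  by (auto simp: lower_def upper_def)

text \<open>Both sides count sets with a chosen point above all other members: given that point
  \<open>y\<close>, the rest is an \<open>m\<close>-subset of its lower set.\<close>

lemma sum_card_tops:
  assumes fin: "finite A"
  shows "(\<Sum>X | X \<subseteq> A \<and> card X = Suc m. card {y \<in> X. \<forall>a\<in>X - {y}. (a, y) \<in> r}) =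
    (\<Sum>y\<in>A. card (lower r A y) choose m)"
proof -
  let ?S = "{X. X \<subseteq> A \<and> card X = Suc m}"
  have finS: "finite ?S" using fin by simp
  have "(\<Sum>X\<in>?S. card {y \<in> X. \<forall>a\<in>X - {y}. (a, y) \<in> r}) =
      (\<Sum>X\<in>?S. \<Sum>y | y \<in> A \<and> (y \<in> X \<and> (\<forall>a\<in>X - {y}. (a, y) \<in> r)). 1)"
  proof (rule sum.cong[OF refl])
    fix X assume "X \<in> ?S"
    then have "{y \<in> X. \<forall>a\<in>X - {y}. (a, y) \<in> r} =
        {y. y \<in> A \<and> (y \<in> X \<and> (\<forall>a\<in>X - {y}. (a, y) \<in> r))}" by blast
    then show "card {y \<in> X. \<forall>a\<in>X - {y}. (a, y) \<in> r} =
        (\<Sum>y | y \<in> A \<and> (y \<in> X \<and> (\<forall>a\<in>X - {y}. (a, y) \<in> r)). 1)" by simp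
  qed
  also have "\<dots> = (\<Sum>y\<in>A. \<Sum>X | X \<in> ?S \<and> (y \<in> X \<and> (\<forall>a\<in>X - {y}. (a, y) \<in> r)). 1)"
    by (rule sum.swap_restrict[OF finS fin])
  also have "\<dots> = (\<Sum>y\<in>A. card (lower r A y) choose m)"
  proof (rule sum.cong[OF refl])
    fix y assume y: "y \<in> A"
    have notin: "y \<notin> lower r A y" by (simp add: lower_def)
    have finl: "finite (lower r A y)" using fin lower_subset by (rule finite_subset[rotated])
    let ?Z = "{Z. Z \<subseteq> lower r A y \<and> card Z = m}"
    let ?X = "{X. X \<in> ?S \<and> (y \<in> X \<and> (\<forall>a\<in>X - {y}. (a, y) \<in> r))}"
    have "bij_betw (insert y) ?Z ?X"
    proof (rule bij_betw_byWitness[where f' = "\<lambda>X. X - {y}"])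
      show "\<forall>Z\<in>?Z. insert y Z - {y} = Z" using notin by auto
      show "\<forall>X\<in>?X. insert y (X - {y}) = X" by auto
      show "insert y ` ?Z \<subseteq> ?X"
      proof (rule image_subsetI)
        fix Z assume Z: "Z \<in> ?Z"
        then have "finite Z" "y \<notin> Z" "Z \<subseteq> A"
          using finite_subset[OF _ finl] notin lower_subset[of r A y] by auto
        then show "insert y Z \<in> ?X" using Z y by (auto simp: lower_def)
      qed
      show "(\<lambda>X. X - {y}) ` ?X \<subseteq> ?Z"
      proof (rule image_subsetI)
        fix X assume X: "X \<in> ?X"
        then have "card (X - {y}) = m" by simp
        then show "X - {y} \<in> ?Z" using X by (auto simp: lower_def)
      qed
    qed
    then have "card ?Z = card ?X" by (rule bij_betw_same_card)
    moreover have "card ?Z = card (lower r A y) choose m" using finl by (rule n_subsets)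
    ultimately show
      "(\<Sum>X | X \<in> ?S \<and> (y \<in> X \<and> (\<forall>a\<in>X - {y}. (a, y) \<in> r)). 1) =
        card (lower r A y) choose m" by simp
  qed
  finally show ?thesis .
qed

text \<open>Kelly's lemma applied to sets with a chosen top gives the binomial moments of the down
  degrees, for all orders below \<open>card A - 1\<close>.\<close>

lemma same_cards_sum_choose_lower:
  assumes sc: "same_cards r A s B" and fin: "finite A" and m: "Suc m < card A"
  shows "(\<Sum>y\<in>A. card (lower r A y) choose m) = (\<Sum>y\<in>B. card (lower s B y) choose m)"
proof -
  have finB: "finite B" using same_cards_card[OF sc] m card.infinite by fastforce
  show ?thesis
    unfolding sum_card_tops[OF fin, symmetric] sum_card_tops[OF finB, symmetric]
  proof (rule kelly[OF sc fin m])
    fix X Y assume "iso_on r X s Y"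
    then obtain f where f: "bij_betw f X Y"
      and o: "\<And>x y. x \<in> X \<Longrightarrow> y \<in> X \<Longrightarrow> (x, y) \<in> r \<longleftrightarrow> (f x, f y) \<in> s"
      unfolding iso_on_def by blast
    have inj: "f a = f b \<longleftrightarrow> a = b" if "a \<in> X" "b \<in> X" for a b
      using f that by (auto simp: bij_betw_def inj_on_eq_iff)
    have im: "f ` X = Y" using f by (simp add: bij_betw_def)
    have "bij_betw f {y \<in> X. \<forall>a\<in>X - {y}. (a, y) \<in> r} {y \<in> Y. \<forall>a\<in>Y - {y}. (a, y) \<in> s}"
    proof (rule bij_betw_subset[OF f])
      show "f ` {y \<in> X. \<forall>a\<in>X - {y}. (a, y) \<in> r} = {y \<in> Y. \<forall>a\<in>Y - {y}. (a, y) \<in> s}"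
        unfolding im[symmetric] using o inj by auto
    qed blast
    then show
      "card {y \<in> X. \<forall>a\<in>X - {y}. (a, y) \<in> r} = card {y \<in> Y. \<forall>a\<in>Y - {y}. (a, y) \<in> s}"
      by (rule bij_betw_same_card)
  qed
qed

text \<open>Both sides count triples with \<open>a\<close> below \<open>y\<close> and
  \<open>y\<close> below \<open>b\<close>, grouped by their underlying set or by their middle
  point.\<close>

lemma sum_card_paths:
  assumes fin: "finite A" and anti: "antisym r"
  shows "(\<Sum>X | X \<subseteq> A \<and> card X = 3.
      card {(a, y, b). a \<in> X \<and> y \<in> X \<and> b \<in> X \<and> a \<noteq> y \<and> b \<noteq> y \<and> (a, y) \<in> r \<and> (y, b) \<in> r}) =
    (\<Sum>y\<in>A. card (lower r A y) * card (upper r A y))"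
proof -
  let ?S = "{X. X \<subseteq> A \<and> card X = 3}"
  let ?T = "{(a, y, b). a \<in> A \<and> y \<in> A \<and> b \<in> A \<and> a \<noteq> y \<and> b \<noteq> y \<and> (a, y) \<in> r \<and> (y, b) \<in> r}"
  have finS: "finite ?S" using fin by simp
  have finT: "finite ?T"
    by (rule finite_subset[of _ "A \<times> A \<times> A"]) (use fin in auto)
  have "(\<Sum>X\<in>?S. card {(a, y, b). a \<in> X \<and> y \<in> X \<and> b \<in> X \<and> a \<noteq> y \<and> b \<noteq> y \<and> (a, y) \<in> r \<and> (y, b) \<in> r}) =
      (\<Sum>X\<in>?S. \<Sum>t | t \<in> ?T \<and> (fst t \<in> X \<and> fst (snd t) \<in> X \<and> snd (snd t) \<in> X). 1)"
  proof (rule sum.cong[OF refl])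
    fix X assume "X \<in> ?S"
    then have
      "{(a, y, b). a \<in> X \<and> y \<in> X \<and> b \<in> X \<and> a \<noteq> y \<and> b \<noteq> y \<and> (a, y) \<in> r \<and> (y, b) \<in> r} =
        {t. t \<in> ?T \<and> (fst t \<in> X \<and> fst (snd t) \<in> X \<and> snd (snd t) \<in> X)}" by auto
    then show
      "card {(a, y, b). a \<in> X \<and> y \<in> X \<and> b \<in> X \<and> a \<noteq> y \<and> b \<noteq> y \<and> (a, y) \<in> r \<and> (y, b) \<in> r} =
        (\<Sum>t | t \<in> ?T \<and> (fst t \<in> X \<and> fst (snd t) \<in> X \<and> snd (snd t) \<in> X). 1)" by simp
  qed
  also have "\<dots> = (\<Sum>t\<in>?T. \<Sum>X | X \<in> ?S \<and> (fst t \<in> X \<and> fst (snd t) \<in> X \<and> snd (snd t) \<in> X). 1)"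
    by (rule sum.swap_restrict[OF finS finT])
  also have "\<dots> = (\<Sum>t\<in>?T. 1)"
  proof (rule sum.cong[OF refl])
    fix t assume "t \<in> ?T"
    then obtain a y b where t: "t = (a, y, b)" "a \<in> A" "y \<in> A" "b \<in> A" "a \<noteq> y"
      "b \<noteq> y"
      "(a, y) \<in> r" "(y, b) \<in> r" by blast
    \<comment> \<open>Antisymmetry excludes \<open>a = b\<close>, so the triple spans exactly one
      three-element set.\<close>
    have "a \<noteq> b" using t anti by (auto dest: antisymD)
    then have c: "card {a, y, b} = 3" using t by simp
    have "X = {a, y, b}" if "X \<subseteq> A" "card X = 3" "a \<in> X" "y \<in> X" "b \<in> X" for X
    proof (rule sym, rule card_subset_eq)
      show "finite X" using that(1) fin by (rule finite_subset)
    qed (use that c in auto)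
    then have
      "{X. X \<in> ?S \<and> (fst t \<in> X \<and> fst (snd t) \<in> X \<and> snd (snd t) \<in> X)} = {{a, y, b}}"
      using c t by auto
    then show
      "(\<Sum>X | X \<in> ?S \<and> (fst t \<in> X \<and> fst (snd t) \<in> X \<and> snd (snd t) \<in> X). 1) = (1 :: nat)"
      by simp
  qed
  also have "\<dots> = card ?T" by simp
  also have "\<dots> = card (SIGMA y : A. lower r A y \<times> upper r A y)"
  proof (rule bij_betw_same_card, rule bij_betw_byWitness[where f' = "\<lambda>(y, a, b). (a, y, b)"])
    show "\<forall>a'\<in>?T. (case case a' of (a, y, b) \<Rightarrow> (y, a, b) of (y, a, b) \<Rightarrow> (a, y, b)) = a'" by auto
  qed (auto simp: lower_def upper_def)
  also have "\<dots> = (\<Sum>y\<in>A. card (lower r A y) * card (upper r A y))"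
    using fin finite_subset[OF lower_subset fin] finite_subset[OF upper_subset fin]
    by (simp add: card_SigmaI card_cartesian_product)
  finally show ?thesis .
qed

lemma same_cards_sum_lower_upper:
  assumes sc: "same_cards r A s B" and fin: "finite A" and card: "3 < card A"
    and anti: "antisym r" "antisym s"
  shows "(\<Sum>y\<in>A. card (lower r A y) * card (upper r A y)) =
    (\<Sum>y\<in>B. card (lower s B y) * card (upper s B y))"
proof -
  have finB: "finite B" using same_cards_card[OF sc] card card.infinite by fastforce
  show ?thesis
    unfolding sum_card_paths[OF fin anti(1), symmetric] sum_card_paths[OF finB anti(2), symmetric]
  proof (rule kelly[OF sc fin card])
    fix X Y assume "iso_on r X s Y"
    then obtain f where f: "bij_betw f X Y"
      and o: "\<And>x y. x \<in> X \<Longrightarrow> y \<in> X \<Longrightarrow> (x, y) \<in> r \<longleftrightarrow> (f x, f y) \<in> s"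
      unfolding iso_on_def by blast
    have inj: "f a = f b \<longleftrightarrow> a = b" if "a \<in> X" "b \<in> X" for a b
      using f that by (auto simp: bij_betw_def inj_on_eq_iff)
    have im: "f ` X = Y" using f by (simp add: bij_betw_def)
    let ?V = "{(a, y, b). a \<in> X \<and> y \<in> X \<and> b \<in> X \<and> a \<noteq> y \<and> b \<noteq> y \<and> (a, y) \<in> r \<and> (y, b) \<in> r}"
    let ?W = "{(a, y, b). a \<in> Y \<and> y \<in> Y \<and> b \<in> Y \<and> a \<noteq> y \<and> b \<noteq> y \<and> (a, y) \<in> s \<and> (y, b) \<in> s}"
    let ?F = "\<lambda>(a, y, b). (f a, f y, f b)"
    have "bij_betw ?F ?V ?W"
    proof (rule bij_betw_imageI)
      show "inj_on ?F ?V" by (auto simp: inj_on_def inj)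
      show "?F ` ?V = ?W"
      proof
        show "?F ` ?V \<subseteq> ?W" using o inj im by auto
        show "?W \<subseteq> ?F ` ?V"
        proof
          fix t assume "t \<in> ?W"
          then obtain a y b where t: "t = (f a, f y, f b)" "a \<in> X" "y \<in> X" "b \<in> X"
            "f a \<noteq> f y" "f b \<noteq> f y" "(f a, f y) \<in> s" "(f y, f b) \<in> s"
            unfolding im[symmetric] by blast
          then have "(a, y, b) \<in> ?V" using o by auto
          then show "t \<in> ?F ` ?V" using t(1) by force
        qed
      qed
    qed
    then show "card ?V = card ?W" by (rule bij_betw_same_card)
  qed
qed

section \<open>Distributions of degrees from their moments\<close>

lemma sum_eq_if_sum_choose_eq:
  fixes f :: "'a \<Rightarrow> nat" and g :: "'b \<Rightarrow> nat" and h :: "nat \<Rightarrow> int"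
  assumes fin: "finite A" "finite B"
    and bound: "\<And>a. a \<in> A \<Longrightarrow> f a \<le> N"
      "\<And>b. b \<in> B \<Longrightarrow> g b \<le> N"
    and eq: "\<And>m. m \<le> N \<Longrightarrow> (\<Sum>a\<in>A. f a choose m) = (\<Sum>b\<in>B. g b choose m)"
  shows "(\<Sum>a\<in>A. h (f a)) = (\<Sum>b\<in>B. h (g b))"
proof -
  have by_valueA:
    "(\<Sum>a\<in>A. k (f a)) = (\<Sum>v\<le>N. int (card {a \<in> A. f a = v}) * k v)" for k
  proof -
    have "(\<Sum>a\<in>A. k (f a)) = (\<Sum>v\<le>N. \<Sum>a\<in>{a \<in> A. f a = v}. k (f a))"
      using fin bound by (intro sum.group[symmetric]) auto
    then show ?thesis by simp
  qed
  have by_valueB: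
    "(\<Sum>a\<in>B. k (g a)) = (\<Sum>v\<le>N. int (card {a \<in> B. g a = v}) * k v)" for k
  proof -
    have "(\<Sum>a\<in>B. k (g a)) = (\<Sum>v\<le>N. \<Sum>a\<in>{a \<in> B. g a = v}. k (g a))"
      using fin bound by (intro sum.group[symmetric]) auto
    then show ?thesis by simp
  qed
  \<comment> \<open>\<open>w choose v\<close> vanishes for \<open>w < v\<close>, so the moments form
    a triangular system in the numbers of points of each value, which is solved from
    \<open>N\<close> downwards.\<close>
  have "card {a \<in> A. f a = v} = card {b \<in> B. g b = v}" if "v \<le> N" for v
    using that
  proof (induction "N - v" arbitrary: v rule: less_induct)
    case less
    have split: "{..N} = insert v ({..<v} \<union> {v<..N})" using less.prems by auto
    have parts:
      "(\<Sum>w\<le>N. c w * int (w choose v)) = c v + (\<Sum>w\<in>{v<..N}. c w * int (w choose v))" for c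
    proof -
      have "(\<Sum>w\<in>{..<v} \<union> {v<..N}. c w * int (w choose v)) =
          (\<Sum>w<v. c w * int (w choose v)) + (\<Sum>w\<in>{v<..N}. c w * int (w choose v))"
        by (rule sum.union_disjoint) auto
      moreover have "(\<Sum>w<v. c w * int (w choose v)) = 0" by (rule sum.neutral) auto
      ultimately show ?thesis unfolding split by (subst sum.insert) auto
    qed
    have "int (\<Sum>a\<in>A. f a choose v) = int (\<Sum>b\<in>B. g b choose v)"
      using eq[OF less.prems] by simp
    then have "(\<Sum>w\<le>N. int (card {a \<in> A. f a = w}) * int (w choose v)) =
        (\<Sum>w\<le>N. int (card {b \<in> B. g b = w}) * int (w choose v))"
      using by_valueA[of "\<lambda>w. int (w choose v)"] by_valueB[of
        "\<lambda>w. int (w choose v)"] by simp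
    moreover have "(\<Sum>w\<in>{v<..N}. int (card {a \<in> A. f a = w}) * int (w choose v)) =
        (\<Sum>w\<in>{v<..N}. int (card {b \<in> B. g b = w}) * int (w choose v))"
      by (rule sum.cong) (use less.hyps in auto)
    ultimately show ?case unfolding parts by simp
  qed
  then show ?thesis unfolding by_valueA by_valueB by simp
qed

text \<open>
  Given the two marginal distributions, the sum of the products is minimal exactly if large
  values of the one function occur with small values of the other.
\<close>

lemma antitone_transfer:
  fixes d u :: "'a \<Rightarrow> nat" and d' u' :: "'b \<Rightarrow> nat"
  assumes fin: "finite A" "finite B"
    and d: "\<And>h :: nat \<Rightarrow> int. (\<Sum>a\<in>A. h (d a)) = (\<Sum>b\<in>B. h (d' b))"
    and u: "\<And>h :: nat \<Rightarrow> int. (\<Sum>a\<in>A. h (u a)) = (\<Sum>b\<in>B. h (u' b))"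
    and prod: "(\<Sum>a\<in>A. d a * u a) = (\<Sum>b\<in>B. d' b * u' b)"
    and anti:
      "\<And>a b. a \<in> A \<Longrightarrow> b \<in> A \<Longrightarrow> d a < d b \<Longrightarrow> u a \<ge> u b"
    and ab: "a \<in> B" "b \<in> B" "d' a < d' b"
  shows "u' a \<ge> u' b"
proof (rule ccontr)
  assume "\<not> u' a \<ge> u' b"
  then have uab: "u' a < u' b" by simp
  define N where "N = (\<Sum>a\<in>A. d a + u a) + (\<Sum>b\<in>B. d' b + u' b)"
  have "d x + u x \<le> (\<Sum>a\<in>A. d a + u a)" if "x \<in> A" for x
    using fin(1) that by (intro member_le_sum) auto
  then have NA: "d x \<le> N" "u x \<le> N" if "x \<in> A" for x using that
    by (fastforce simp: N_def)+
  have "d' x + u' x \<le> (\<Sum>b\<in>B. d' b + u' b)" if "x \<in> B" for x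
    using fin(2) that by (intro member_le_sum) auto
  then have NB: "d' x \<le> N" "u' x \<le> N" if "x \<in> B" for x using that
    by (fastforce simp: N_def)+
  \<comment> \<open>Writing a value as the number of thresholds it reaches turns the sum of products
    into a sum of the sizes of all quadrants \<open>?A s t\<close> or \<open>?B s t\<close>.\<close>
  have count: "j = (\<Sum>i\<in>{1..N}. of_bool (i \<le> j))" if "j \<le> N" for j :: nat
  proof -
    have "{1..N} \<inter> {i. i \<le> j} = {1..j}" using that by auto
    then show ?thesis by (simp add: of_bool_def sum.If_cases)
  qed
  let ?A = "\<lambda>s t. {x \<in> A. s \<le> d x \<and> t \<le> u x}" and ?B = "\<lambda>s t. {x \<in> B. s \<le> d' x \<and> t \<le> u' x}"
  have prodA: "(\<Sum>x\<in>A. d x * u x) = (\<Sum>s\<in>{1..N}. \<Sum>t\<in>{1..N}. card (?A s t))"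
  proof -
    have "(\<Sum>x\<in>A. d x * u x) = (\<Sum>x\<in>A. \<Sum>s\<in>{1..N}. \<Sum>t\<in>{1..N}. of_bool (s \<le> d x \<and> t \<le> u x))"
    proof (rule sum.cong[OF refl])
      fix x assume x: "x \<in> A"
      have "d x * u x = (\<Sum>s\<in>{1..N}. of_bool (s \<le> d x)) * (\<Sum>t\<in>{1..N}. of_bool (t \<le> u x))"
        using count[OF NA(1)[OF x]] count[OF NA(2)[OF x]] by simp
      then show
        "d x * u x = (\<Sum>s\<in>{1..N}. \<Sum>t\<in>{1..N}. of_bool (s \<le> d x \<and> t \<le> u x))"
        by (simp only: sum_product of_bool_conj)
    qed
    also have "\<dots> = (\<Sum>s\<in>{1..N}. \<Sum>t\<in>{1..N}. \<Sum>x\<in>A. of_bool (s \<le> d x \<and> t \<le> u x))"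
      by (rule trans[OF sum.swap], rule sum.cong[OF refl], rule sum.swap)
    finally show ?thesis using fin(1) by (simp add: of_bool_def sum.If_cases Int_def)
  qed
  have prodB:
    "(\<Sum>x\<in>B. d' x * u' x) = (\<Sum>s\<in>{1..N}. \<Sum>t\<in>{1..N}. card (?B s t))"
  proof -
    have "(\<Sum>x\<in>B. d' x * u' x) = (\<Sum>x\<in>B. \<Sum>s\<in>{1..N}. \<Sum>t\<in>{1..N}. of_bool (s \<le> d' x \<and> t \<le> u' x))"
    proof (rule sum.cong[OF refl])
      fix x assume x: "x \<in> B"
      have "d' x * u' x = (\<Sum>s\<in>{1..N}. of_bool (s \<le> d' x)) * (\<Sum>t\<in>{1..N}. of_bool (t \<le> u' x))"
        using count[OF NB(1)[OF x]] count[OF NB(2)[OF x]] by simp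
      then show
        "d' x * u' x = (\<Sum>s\<in>{1..N}. \<Sum>t\<in>{1..N}. of_bool (s \<le> d' x \<and> t \<le> u' x))"
        by (simp only: sum_product of_bool_conj)
    qed
    also have "\<dots> = (\<Sum>s\<in>{1..N}. \<Sum>t\<in>{1..N}. \<Sum>x\<in>B. of_bool (s \<le> d' x \<and> t \<le> u' x))"
      by (rule trans[OF sum.swap], rule sum.cong[OF refl], rule sum.swap)
    finally show ?thesis using fin(2) by (simp add: of_bool_def sum.If_cases Int_def)
  qed
  have card_d: "card {x \<in> A. s \<le> d x} = card {x \<in> B. s \<le> d' x}" for s
    using d[of "\<lambda>v. of_bool (s \<le> v)"] fin
      by (simp add: of_bool_def sum.If_cases Int_def)
  have card_u: "card {x \<in> A. s \<le> u x} = card {x \<in> B. s \<le> u' x}" for s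
    using u[of "\<lambda>v. of_bool (s \<le> v)"] fin
      by (simp add: of_bool_def sum.If_cases Int_def)
  have card_AB: "card A = card B" using d[of "\<lambda>_. 1"] by simp
  have ieA:
    "card {x \<in> A. p x \<and> q x} + card {x \<in> A. p x \<or> q x} = card {x \<in> A. p x} + card {x \<in> A. q x}" for p q
  proof -
    have "{x \<in> A. p x \<and> q x} = {x \<in> A. p x} \<inter> {x \<in> A. q x}"
      "{x \<in> A. p x \<or> q x} = {x \<in> A. p x} \<union> {x \<in> A. q x}"
      by blast+
    then show ?thesis using card_Un_Int[of "{x \<in> A. p x}" "{x \<in> A. q x}"] fin by simp
  qed
  have ieB:
    "card {x \<in> B. p x \<and> q x} + card {x \<in> B. p x \<or> q x} = card {x \<in> B. p x} + card {x \<in> B. q x}" for p q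
  proof -
    have "{x \<in> B. p x \<and> q x} = {x \<in> B. p x} \<inter> {x \<in> B. q x}"
      "{x \<in> B. p x \<or> q x} = {x \<in> B. p x} \<union> {x \<in> B. q x}"
      by blast+
    then show ?thesis using card_Un_Int[of "{x \<in> B. p x}" "{x \<in> B. q x}"] fin by simp
  qed
  \<comment> \<open>A point reaching both thresholds and a point reaching neither would violate
    \<open>anti\<close>. Hence \<open>A\<close> has the fewest points in the quadrant that its
    marginals allow.\<close>
  have A_cases: "?A s t = {} \<or> {x \<in> A. s \<le> d x \<or> t \<le> u x} = A" for s t
  proof (rule ccontr)
    assume "\<not> (?A s t = {} \<or> {x \<in> A. s \<le> d x \<or> t \<le> u x} = A)"
    then obtain x y where "x \<in> A" "s \<le> d x" "t \<le> u x" "y \<in> A"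
      "\<not> (s \<le> d y \<or> t \<le> u y)"
      by blast
    then show False using anti[of y x] by linarith
  qed
  have sum_cards: "card (?A s t) + card {x \<in> A. s \<le> d x \<or> t \<le> u x} =
      card (?B s t) + card {x \<in> B. s \<le> d' x \<or> t \<le> u' x}" for s t
    using ieA[of "\<lambda>x. s \<le> d x" "\<lambda>x. t \<le> u x"] ieB[of
      "\<lambda>x. s \<le> d' x" "\<lambda>x. t \<le> u' x"] card_d card_u by simp
  have le: "card (?A s t) \<le> card (?B s t)" for s t
    using A_cases[of s t]
  proof
    assume "{x \<in> A. s \<le> d x \<or> t \<le> u x} = A"
    moreover have "card {x \<in> B. s \<le> d' x \<or> t \<le> u' x} \<le> card B" using fin
      by (intro card_mono) auto
    ultimately show ?thesis using sum_cards[of s t] card_AB by simp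
  qed (simp only: card.empty)
  \<comment> \<open>At the values of \<open>b\<close>, the point \<open>b\<close> lies in the
    quadrant while \<open>a\<close> reaches neither threshold, so \<open>B\<close> exceeds the
    minimum here.\<close>
  have less: "card (?A (d' b) (u' b)) < card (?B (d' b) (u' b))"
    using A_cases[of "d' b" "u' b"]
  proof
    assume empty: "?A (d' b) (u' b) = {}"
    have "0 < card (?B (d' b) (u' b))" unfolding card_gt_0_iff using ab fin by auto
    then show ?thesis unfolding empty by (simp only: card.empty)
  next
    assume "{x \<in> A. d' b \<le> d x \<or> u' b \<le> u x} = A"
    moreover have "card {x \<in> B. d' b \<le> d' x \<or> u' b \<le> u' x} < card B"
    proof (rule psubset_card_mono[OF fin(2)])
      have "a \<notin> {x \<in> B. d' b \<le> d' x \<or> u' b \<le> u' x}" using ab(3) uab by simp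
      then show "{x \<in> B. d' b \<le> d' x \<or> u' b \<le> u' x} \<subset> B" using ab(1)
        by blast
    qed
    ultimately show ?thesis using sum_cards[of "d' b" "u' b"] card_AB by simp
  qed
  have "(\<Sum>s\<in>{1..N}. \<Sum>t\<in>{1..N}. card (?A s t)) < (\<Sum>s\<in>{1..N}. \<Sum>t\<in>{1..N}. card (?B s t))"
  proof (rule sum_strict_mono_ex1)
    have "(\<Sum>t\<in>{1..N}. card (?A (d' b) t)) < (\<Sum>t\<in>{1..N}. card (?B (d' b) t))"
    proof (rule sum_strict_mono_ex1)
      show "\<exists>t\<in>{1..N}. card (?A (d' b) t) < card (?B (d' b) t)"
        using less NB(2)[OF ab(2)] uab by (intro bexI[of _ "u' b"]) auto
    qed (use le in auto)
    then show
      "\<exists>s\<in>{1..N}. (\<Sum>t\<in>{1..N}. card (?A s t)) < (\<Sum>t\<in>{1..N}. card (?B s t))"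
      using NB(1)[OF ab(2)] ab(3) by (intro bexI[of _ "d' b"]) auto
  qed (use le in \<open>auto intro: sum_mono\<close>)
  then show False using prodA prodB prod by simp
qed

section \<open>The orbit of the minimal point\<close>

text \<open>A translation-invariant relation: comparability depends on the difference only.\<close>

definition gap :: "nat set \<Rightarrow> nat rel" where
  "gap D = {(i, j). i = j \<or> i < j \<and> j - i \<in> D}"

lemma lower_gap:
  assumes "0 \<notin> D" "i < n"
  shows "lower (gap D) {..<n} i = (\<lambda>d. i - d) ` (D \<inter> {..i})"
proof (intro equalityI subsetI)
  fix j assume "j \<in> lower (gap D) {..<n} i"
  then have "j < i" "i - j \<in> D" by (auto simp: lower_def gap_def)
  then show "j \<in> (\<lambda>d. i - d) ` (D \<inter> {..i})"
    by (intro image_eqI[of _ _ "i - j"]) auto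
next
  fix j assume "j \<in> (\<lambda>d. i - d) ` (D \<inter> {..i})"
  then obtain d where d: "j = i - d" "d \<in> D" "d \<le> i" by auto
  then have "d > 0" using assms(1) by (cases d) auto
  then show "j \<in> lower (gap D) {..<n} i" using d assms(2) by (auto simp: lower_def gap_def)
qed

lemma upper_gap:
  assumes "0 \<notin> D" "i < n"
  shows "upper (gap D) {..<n} i = (\<lambda>d. i + d) ` (D \<inter> {..<n - i})"
proof (intro equalityI subsetI)
  fix j assume "j \<in> upper (gap D) {..<n} i"
  then have "i < j" "j - i \<in> D" "j < n" by (auto simp: upper_def gap_def)
  then show "j \<in> (\<lambda>d. i + d) ` (D \<inter> {..<n - i})"
    by (intro image_eqI[of _ _ "j - i"]) auto
next
  fix j assume "j \<in> (\<lambda>d. i + d) ` (D \<inter> {..<n - i})"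
  then obtain d where d: "j = i + d" "d \<in> D" "d < n - i" by auto
  then have "d > 0" using assms(1) by (cases d) auto
  then show "j \<in> upper (gap D) {..<n} i" using d assms(2) by (auto simp: upper_def gap_def)
qed

lemma card_lower_gap: "0 \<notin> D \<Longrightarrow> i < n \<Longrightarrow> card (lower (gap D) {..<n} i) = card (D \<inter> {..i})"
  unfolding lower_gap by (rule card_image) (auto simp: inj_on_def)

lemma card_upper_gap: "0 \<notin> D \<Longrightarrow> i < n \<Longrightarrow> card (upper (gap D) {..<n} i) = card (D \<inter> {..<n - i})"
  unfolding upper_gap by (rule card_image) (auto simp: inj_on_def)

text \<open>Reflecting the segment preserves distances, so statements about lower sets can be reused
  for upper sets.\<close>

lemma gap_self_dual: "iso_on ((gap D)\<inverse>) {..<n} (gap D) {..<n}"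
proof (rule iso_onI)
  show "bij_betw (\<lambda>i. n - 1 - i) {..<n} {..<n}"
    by (rule bij_betw_byWitness[where f' = "\<lambda>i. n - 1 - i"]) auto
  fix i j assume ij: "i \<in> {..<n}" "j \<in> {..<n}"
  then have "n - 1 - j - (n - 1 - i) = i - j" by simp
  moreover have "n - 1 - i < n - 1 - j \<longleftrightarrow> j < i"
    "n - 1 - i = n - 1 - j \<longleftrightarrow> i = j" using ij by auto
  ultimately show
    "(i, j) \<in> (gap D)\<inverse> \<longleftrightarrow> (n - 1 - i, n - 1 - j) \<in> gap D"
      by (auto simp: gap_def)
qed

lemma bij_betw_lower:
  assumes "bij_betw f A B"
    "\<And>x y. x \<in> A \<Longrightarrow> y \<in> A \<Longrightarrow> (x, y) \<in> r \<longleftrightarrow> (f x, f y) \<in> s" "x \<in> A"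
  shows "f ` lower r A x = lower s B (f x)"
proof -
  have inj: "f a = f b \<longleftrightarrow> a = b" if "a \<in> A" "b \<in> A" for a b
    using assms(1) that by (auto simp: bij_betw_def inj_on_eq_iff)
  have "B = f ` A" using assms(1) by (simp add: bij_betw_def)
  then show ?thesis unfolding lower_def using assms(2,3) inj by auto
qed

lemma bij_betw_upper:
  assumes "bij_betw f A B"
    "\<And>x y. x \<in> A \<Longrightarrow> y \<in> A \<Longrightarrow> (x, y) \<in> r \<longleftrightarrow> (f x, f y) \<in> s" "x \<in> A"
  shows "f ` upper r A x = upper s B (f x)"
proof -
  have inj: "f a = f b \<longleftrightarrow> a = b" if "a \<in> A" "b \<in> A" for a b
    using assms(1) that by (auto simp: bij_betw_def inj_on_eq_iff)
  have "B = f ` A" using assms(1) by (simp add: bij_betw_def)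
  then show ?thesis unfolding upper_def using assms(2,3) inj by auto
qed

lemma card_image_subset: "bij_betw f A B \<Longrightarrow> X \<subseteq> A \<Longrightarrow> card (f ` X) = card X"
  by (meson bij_betw_imp_inj_on card_image inj_on_subset)

lemma iso_on_sum_lower:
  fixes g :: "nat \<Rightarrow> int"
  assumes "iso_on r A s B"
  shows "(\<Sum>x\<in>A. g (card (lower r A x))) = (\<Sum>y\<in>B. g (card (lower s B y)))"
proof -
  obtain f where f: "bij_betw f A B" and o:
    "\<And>x y. x \<in> A \<Longrightarrow> y \<in> A \<Longrightarrow> (x, y) \<in> r \<longleftrightarrow> (f x, f y) \<in> s"
    using assms unfolding iso_on_def by blast
  have "card (lower r A x) = card (lower s B (f x))" if "x \<in> A" for x
    using bij_betw_lower[of f A B r s x, OF f o that] card_image_subset[OF f lower_subset] by metis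
  then show ?thesis using sum.reindex_bij_betw[OF f, of "\<lambda>y. g (card (lower s B y))"]
    by simp
qed

text \<open>
  The orbit of \<open>l\<close> under an isomorphism \<open>P - h \<cong> P - l\<close> ends in \<open>h\<close>. Points outside of this
  orbit lie on cycles, and a comparability between such a point and a point of the orbit could be
  transported to \<open>l\<close> or to \<open>h\<close>.
\<close>

lemma minmax_connected_imp_iso_on_gap:
  assumes fin: "finite V" and con: "connected_on r V" and refl:
    "\<And>x. x \<in> V \<Longrightarrow> (x, x) \<in> r"
    and l: "l \<in> V" "lower r V l = {}" and h: "h \<in> V" "upper r V h = {}"
    and iso: "iso_on r (V - {h}) r (V - {l})"
  obtains D where "D \<subseteq> {1..<card V}" "iso_on r V (gap D) {..<card V}"
    "iso_on r (V - {h}) (gap D) {..<card V - 1}"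
proof -
  obtain f where f: "bij_betw f (V - {h}) (V - {l})"
    and o: "\<And>x y. x \<in> V - {h} \<Longrightarrow> y \<in> V - {h} \<Longrightarrow> (x, y) \<in> r \<longleftrightarrow> (f x, f y) \<in> r"
    using iso unfolding iso_on_def by blast
  \<comment> \<open>The orbit of \<open>l\<close>. Nothing is known about \<open>f\<close> at
    \<open>h\<close>, so facts about \<open>c\<close> hold only up to the first visit to
    \<open>h\<close>.\<close>
  define c where "c i = (f ^^ i) l" for i
  have c0: "c 0 = l" and cS: "c (Suc i) = f (c i)" for i by (simp_all add: c_def)
  have fV: "f x \<in> V" "f x \<noteq> l" if "x \<in> V" "x \<noteq> h" for x
    using bij_betwE[OF f] that by blast+
  have finj: "x = y" if "x \<in> V" "x \<noteq> h" "y \<in> V" "y \<noteq> h" "f x = f y" for x y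
    using f that by (auto simp: bij_betw_def inj_on_def)
  have cV: "c i \<in> V" if "\<And>i. i < m \<Longrightarrow> c i \<noteq> h" "i \<le> m" for i m
    using that by (induction i) (auto simp: c0 cS l fV)
  \<comment> \<open>A repetition could be pulled back along the injective \<open>f\<close> to
    \<open>l\<close>, which is not a value of \<open>f\<close> on \<open>V - {h}\<close>.\<close>
  have cneq: "c i \<noteq> c j"
    if "\<And>i. i < m \<Longrightarrow> c i \<noteq> h" "i < j" "j \<le> m" for i j m
    using that(2,3)
  proof (induction i arbitrary: j)
    case 0
    then obtain j' where "j = Suc j'" by (cases j) auto
    then show ?case using 0 fV(2)[of "c j'"] cV[OF that(1), of m j'] that(1)[of j']
      by (simp add: c0 cS)
  next
    case (Suc i)
    then obtain j' where j: "j = Suc j'" by (cases j) auto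
    show ?case
    proof
      assume "c (Suc i) = c j"
      then have "c i = c j'"
        using Suc.prems j finj[of "c i" "c j'"] cV[OF that(1), of m i]
          cV[OF that(1), of m j'] that(1)[of i] that(1)[of j']
        by (simp add: cS)
      then show False using Suc.IH[of j'] Suc.prems j by simp
    qed
  qed
  \<comment> \<open>An orbit avoiding \<open>h\<close> would contain \<open>card V + 1\<close>
    different points of \<open>V\<close>.\<close>
  have "\<exists>m. c m = h"
  proof (rule ccontr)
    assume no: "\<nexists>m. c m = h"
    have "inj_on c {..card V}"
      by (rule linorder_inj_onI) (use cneq[of "card V"] no in auto)
    moreover have "c ` {..card V} \<subseteq> V" using cV[of "card V"] no by auto
    ultimately have "card {..card V} \<le> card V" using fin card_inj_on_le by blast
    then show False by simp
  qed
  define m where "m = (LEAST m. c m = h)"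
  have cm: "c m = h" unfolding m_def using \<open>\<exists>m. c m = h\<close> by (rule LeastI_ex)
  have cnh: "c i \<noteq> h" if "i < m" for i using that unfolding m_def by (rule not_less_Least)
  have cV: "c i \<in> V" if "i \<le> m" for i using cV[of m i] cnh that by simp
  have cneq: "c i \<noteq> c j" if "i < j" "j \<le> m" for i j using cneq[of m i j] cnh that by simp
  have shift: "(c i, c j) \<in> r \<longleftrightarrow> (c (i + n), c (j + n)) \<in> r"
    if "i + n \<le> m" "j + n \<le> m" for i j n
    using that
  proof (induction n)
    case (Suc n)
    then have "c (i + n) \<in> V - {h}" "c (j + n) \<in> V - {h}" using cV cnh by auto
    then show ?case using Suc o by (simp add: cS)
  qed simp
  define C where "C = c ` {..m}"
  have CV: "C \<subseteq> V" using cV by (auto simp: C_def)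
  have hC: "h \<in> C" unfolding C_def cm[symmetric] by simp
  have lC: "l \<in> C" unfolding C_def c0[symmetric] by simp
  have fR: "f x \<in> V - C" if x: "x \<in> V - C" for x
  proof -
    have xh: "x \<noteq> h" using x hC by blast
    have "f x \<noteq> c j" if "j \<le> m" for j
    proof (cases j)
      case 0
      then show ?thesis using fV(2) x xh by (simp add: c0)
    next
      case (Suc i)
      then have "c i \<in> V" "c i \<noteq> h" "c i \<in> C" using that cV cnh by (auto simp: C_def)
      then show ?thesis using Suc finj[of x "c i"] x xh by (auto simp: cS)
    qed
    then show ?thesis using fV(1) x xh by (auto simp: C_def)
  qed
  have Rh: "V - C \<subseteq> V - {h}" using hC by blast
  \<comment> \<open>Outside the orbit \<open>f\<close> is a permutation, so it can also be applied
    backwards there.\<close>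
  have fRR: "f ` (V - C) = V - C"
  proof (rule endo_inj_surj)
    show "inj_on f (V - C)" using f Rh by (meson bij_betw_imp_inj_on inj_on_subset)
  qed (use fin fR in auto)
  \<comment> \<open>A relation from an outside point to \<open>c i\<close> is pulled back along
    \<open>f\<close> until it ends at the minimal point \<open>l\<close>.\<close>
  have below: "(x, c i) \<notin> r" if "x \<in> V - C" "i \<le> m" for x i
    using that
  proof (induction i arbitrary: x)
    case 0
    then show ?case using l lC by (auto simp: c0 lower_def)
  next
    case (Suc i)
    then obtain y where "y \<in> V - C" "x = f y" using fRR by (metis imageE)
    moreover have "c i \<in> V - {h}" using Suc.prems cV cnh by auto
    ultimately show ?case using Suc o[of y "c i"] Rh by (auto simp: cS)
  qed
  \<comment> \<open>Dually, a relation from the orbit to an outside point is pushed forward until it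
    starts at the maximal point \<open>h\<close>.\<close>
  have above: "(c (m - i), x) \<notin> r" if "x \<in> V - C" "i \<le> m" for x i
    using that
  proof (induction i arbitrary: x)
    case 0
    then show ?case using h hC by (auto simp: cm upper_def)
  next
    case (Suc i)
    then have "Suc (m - Suc i) = m - i" by simp
    then have "c (m - i) = f (c (m - Suc i))" by (metis cS)
    moreover have "c (m - Suc i) \<in> V - {h}" using Suc.prems cV cnh by auto
    ultimately show ?case using Suc o[of "c (m - Suc i)" x] Rh fR by auto
  qed
  have "separated r C (V - C)" unfolding separated_def
  proof (intro ballI)
    fix x y assume "x \<in> C" "y \<in> V - C"
    then obtain i where i: "x = c i" "i \<le> m" by (auto simp: C_def)
    then have "c (m - (m - i)) = x" by simp
    then show "(x, y) \<notin> r \<and> (y, x) \<notin> r"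
      using below[OF \<open>y \<in> V - C\<close> i(2)] above[OF \<open>y \<in> V - C\<close>, of
        "m - i"] i(1) by simp
  qed
  then have VC: "C = V" using con CV lC by (intro connected_onD) auto
  have inj: "inj_on c {..m}" by (rule linorder_inj_onI) (use cneq in auto)
  have "card V = Suc m" using card_image[OF inj] VC by (simp add: C_def)
  have m: "{..<card V} = {..m}" unfolding \<open>card V = Suc m\<close> by auto
  define D where "D = {d. 0 < d \<and> d \<le> m \<and> (c 0, c d) \<in> r}"
  have bij: "bij_betw c {..<card V} V" using inj VC by (simp add: bij_betw_def C_def m)
  have rel: "(i, j) \<in> gap D \<longleftrightarrow> (c i, c j) \<in> r"
    if "i \<in> {..<card V}" "j \<in> {..<card V}" for i j
  proof -
    have ij: "i \<le> m" "j \<le> m" using that by (simp_all add: m)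
    consider "i = j" | "i < j" | "j < i" by linarith
    then show ?thesis
    proof cases
      case 1 then show ?thesis using refl cV ij by (simp add: gap_def)
    next
      case 2
      then show ?thesis using shift[of 0 i "j - i"] ij by (auto simp: gap_def D_def)
    next
      case 3
      \<comment> \<open>A relation against the direction of the orbit would shift to one that ends
        at \<open>l\<close>.\<close>
      have "(c (i - j), c 0) \<notin> r"
      proof
        assume "(c (i - j), c 0) \<in> r"
        then have "c (i - j) = l" using l(2) cV[of "i - j"] ij by (auto simp: lower_def c0)
        moreover have "0 < i - j" "i - j \<le> m" using 3 ij by linarith+
        ultimately show False using cneq[of 0 "i - j"] by (simp add: c0)
      qed
      then show ?thesis using shift[of "i - j" j 0] 3 ij by (auto simp: gap_def)
    qed
  qed
  have "{..<card V - 1} \<subseteq> {..<card V}" by auto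
  moreover have "c ` {..<card V - 1} = V - {h}"
  proof -
    have "{..<card V - 1} = {..m} - {m}" unfolding \<open>card V = Suc m\<close> by auto
    then show ?thesis using inj_on_image_set_diff[OF inj, of "{..m}" "{m}"] VC cm
      by (simp add: C_def)
  qed
  ultimately have "iso_on r (V - {h}) (gap D) {..<card V - 1}"
    using iso_on_image[OF bij rel] iso_on_sym by metis
  moreover have "iso_on r V (gap D) {..<card V}"
    by (rule iso_on_sym, rule iso_onI[OF bij rel])
  moreover have "D \<subseteq> {1..<card V}" unfolding \<open>card V = Suc m\<close>
    by (auto simp: D_def)
  ultimately show ?thesis using that by blast
qed

section \<open>Degrees when a point is put back into its card\<close>

lemma card_lower_without_point:
  assumes D: "0 \<notin> D"
    and f: "bij_betw f (W - {q}) {..<k}"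
    and o: "\<And>x y. x \<in> W - {q} \<Longrightarrow> y \<in> W - {q} \<Longrightarrow> (x, y) \<in> s \<longleftrightarrow> (f x, f y) \<in> gap D"
    and y: "y \<in> W - {q}"
  shows "card (lower s (W - {q}) y) = card (D \<inter> {..f y})"
proof -
  have "f y < k" using bij_betwE[OF f] y by blast
  then show ?thesis
    using bij_betw_lower[of f "W - {q}" "{..<k}" s "gap D" y, OF f o y]
      card_image_subset[OF f lower_subset] card_lower_gap[OF D] by metis
qed

lemma card_lower_one_point_extension:
  assumes fin: "finite W" and q: "q \<in> W" and D: "0 \<notin> D"
    and f: "bij_betw f (W - {q}) {..<k}"
    and o: "\<And>x y. x \<in> W - {q} \<Longrightarrow> y \<in> W - {q} \<Longrightarrow> (x, y) \<in> s \<longleftrightarrow> (f x, f y) \<in> gap D"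
    and y: "y \<in> W - {q}"
  shows "card (lower s W y) = card (D \<inter> {..f y}) + of_bool (y \<in> upper s W q)"
proof -
  have "card (lower s (W - {q}) y) = card (D \<inter> {..f y})"
    by (rule card_lower_without_point[OF D f o y])
  moreover have
    "lower s W y = (if y \<in> upper s W q then insert q (lower s (W - {q}) y) else lower s (W - {q}) y)"
    using q y by (auto simp: lower_def upper_def)
  moreover have "q \<notin> lower s (W - {q}) y" "finite (lower s (W - {q}) y)"
    using fin by (auto simp: lower_def)
  ultimately show ?thesis by simp
qed

lemma card_upper_without_point:
  assumes D: "0 \<notin> D"
    and f: "bij_betw f (W - {q}) {..<k}"
    and o: "\<And>x y. x \<in> W - {q} \<Longrightarrow> y \<in> W - {q} \<Longrightarrow> (x, y) \<in> s \<longleftrightarrow> (f x, f y) \<in> gap D"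
    and y: "y \<in> W - {q}"
  shows "card (upper s (W - {q}) y) = card (D \<inter> {..<k - f y})"
proof -
  have "f y < k" using bij_betwE[OF f] y by blast
  then show ?thesis
    using bij_betw_upper[of f "W - {q}" "{..<k}" s "gap D" y, OF f o y]
      card_image_subset[OF f upper_subset] card_upper_gap[OF D] by metis
qed

lemma card_upper_one_point_extension:
  assumes fin: "finite W" and q: "q \<in> W" and D: "0 \<notin> D"
    and f: "bij_betw f (W - {q}) {..<k}"
    and o: "\<And>x y. x \<in> W - {q} \<Longrightarrow> y \<in> W - {q} \<Longrightarrow> (x, y) \<in> s \<longleftrightarrow> (f x, f y) \<in> gap D"
    and y: "y \<in> W - {q}"
  shows "card (upper s W y) = card (D \<inter> {..<k - f y}) + of_bool (y \<in> lower s W q)"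
proof -
  have "card (upper s (W - {q}) y) = card (D \<inter> {..<k - f y})"
    by (rule card_upper_without_point[OF D f o y])
  moreover have
    "upper s W y = (if y \<in> lower s W q then insert q (upper s (W - {q}) y) else upper s (W - {q}) y)"
    using q y by (auto simp: lower_def upper_def)
  moreover have "q \<notin> upper s (W - {q}) y" "finite (upper s (W - {q}) y)"
    using fin by (auto simp: upper_def)
  ultimately show ?thesis by simp
qed

text \<open>Putting \<open>q\<close> back raises the down degree by one for exactly the points above
  \<open>q\<close>, which accounts for the last sum.\<close>

lemma sum_lower_one_point_extension:
  fixes g :: "nat \<Rightarrow> int"
  assumes fin: "finite W" and q: "q \<in> W" and D: "0 \<notin> D"
    and f: "bij_betw f (W - {q}) {..<k}"
    and o: "\<And>x y. x \<in> W - {q} \<Longrightarrow> y \<in> W - {q} \<Longrightarrow> (x, y) \<in> s \<longleftrightarrow> (f x, f y) \<in> gap D"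
  shows "(\<Sum>y\<in>W. g (card (lower s W y))) = g (card (lower s W q)) + (\<Sum>i<k. g (card (D \<inter> {..i}))) +
    (\<Sum>y\<in>upper s W q. g (Suc (card (D \<inter> {..f y}))) - g (card (D \<inter> {..f y})))"
proof -
  let ?u = "\<lambda>y. card (D \<inter> {..f y})"
  have c: "card (lower s W y) = ?u y + of_bool (y \<in> upper s W q)" if "y \<in> W - {q}" for y
    using card_lower_one_point_extension[OF fin q D f o that] by blast
  have sub: "upper s W q \<subseteq> W - {q}" by (auto simp: upper_def)
  have "(\<Sum>y\<in>W - {q}. g (card (lower s W y))) =
      (\<Sum>y\<in>W - {q}. g (?u y) + (if y \<in> upper s W q then g (Suc (?u y)) - g (?u y) else 0))"
    by (rule sum.cong) (auto simp: c)
  also have "\<dots> = (\<Sum>y\<in>W - {q}. g (?u y)) + (\<Sum>y\<in>upper s W q. g (Suc (?u y)) - g (?u y))"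
    using fin sub by (simp add: sum.distrib sum.If_cases Int_absorb1)
  also have "(\<Sum>y\<in>W - {q}. g (?u y)) = (\<Sum>i<k. g (card (D \<inter> {..i})))"
    using sum.reindex_bij_betw[OF f, of "\<lambda>i. g (card (D \<inter> {..i}))"] .
  finally show ?thesis using sum.remove[OF fin q, of "\<lambda>y. g (card (lower s W y))"] by simp
qed

text \<open>The sum telescopes, because \<open>card (D \<inter> {..d})\<close> grows by one from
  each element \<open>d\<close> of \<open>D\<close> to the next.\<close>

lemma sum_gap_steps:
  fixes g :: "nat \<Rightarrow> int" and D :: "nat set"
  assumes "0 \<notin> D"
  shows "(\<Sum>d\<in>D \<inter> {..k}. g (card (D \<inter> {..d})) - g (card (D \<inter> {..d}) - 1)) = g (card (D \<inter> {..k})) - g 0"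
proof (induction k)
  case 0
  have "D \<inter> {..0} = {}" using assms by auto
  then show ?case by simp
next
  case (Suc k)
  show ?case
  proof (cases "Suc k \<in> D")
    case True
    then have "D \<inter> {..Suc k} = insert (Suc k) (D \<inter> {..k})" by auto
    then show ?thesis using Suc by simp
  next
    case False
    then have "D \<inter> {..Suc k} = D \<inter> {..k}" by (auto simp: le_Suc_eq)
    then show ?thesis using Suc by simp
  qed
qed

section \<open>Extensions by one point\<close>

text \<open>
  The points below \<open>q\<close> are the \<open>X - d\<close> and those above \<open>q\<close> are the \<open>x + d\<close> with \<open>d \<in> D\<close>, for some \<open>x\<close>
  and \<open>X = x + Min D\<close>. Let \<open>t\<close> and \<open>p\<close> be the largest \<open>d\<close> that occur here. If \<open>t + p > k\<close>, then \<open>k - p\<close>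
  has a smaller down degree and a smaller up degree than \<open>q\<close>. Otherwise counting shows that the
  elements of \<open>D\<close> above \<open>t\<close> are the \<open>t + e\<close> with \<open>e \<le> p\<close>, and \<open>t + e - Min D \<in> D\<close> by transitivity
  through \<open>q\<close>, so that \<open>D\<close> is closed under subtraction of \<open>Min D\<close>.
\<close>

lemma not_between_imp_multiples:
  assumes fin: "finite W" and q: "q \<in> W" and tr: "trans s"
    and D: "D \<subseteq> {1..k}" and closed:
      "\<And>d e. d \<in> D \<Longrightarrow> e \<in> D \<Longrightarrow> d + e \<le> k \<Longrightarrow> d + e \<in> D"
    and f: "bij_betw f (W - {q}) {..<k}"
    and o: "\<And>x y. x \<in> W - {q} \<Longrightarrow> y \<in> W - {q} \<Longrightarrow> (x, y) \<in> s \<longleftrightarrow> (f x, f y) \<in> gap D"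
    and deg: "card (lower s W q) + card (upper s W q) = card D"
    and x: "x \<in> lower s W q" "card (upper s (W - {q}) x) = card (upper s W q)"
    and y: "y \<in> upper s W q" "card (lower s (W - {q}) y) = card (lower s W q)"
    and anti:
      "\<And>a b. a \<in> W \<Longrightarrow> b \<in> W \<Longrightarrow> card (lower s W a) < card (lower s W b) \<Longrightarrow>
      card (upper s W a) \<ge> card (upper s W b)"
    and asym: "antisym s"
  shows "\<exists>d\<in>D. \<forall>e\<in>D. d dvd e"
proof -
  have D0: "0 \<notin> D" and finD: "finite D" using D finite_subset by auto
  define L U where "L = f ` lower s W q" and "U = f ` upper s W q"
  have subL: "lower s W q \<subseteq> W - {q}" and subU: "upper s W q \<subseteq> W - {q}"
    by (auto simp: lower_def upper_def)
  have x2: "card (D \<inter> {..<k - f x}) = card (upper s W q)"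
    using card_upper_without_point[OF D0 f o subsetD[OF subL x(1)]] x(2) by simp
  have y2: "card (D \<inter> {..f y}) = card (lower s W q)"
    using card_lower_without_point[OF D0 f o subsetD[OF subU y(1)]] y(2) by simp
  have cardL: "card L = card (lower s W q)" and cardU: "card U = card (upper s W q)"
    unfolding L_def U_def by (rule card_image_subset[OF f subL], rule card_image_subset[OF f subU])
  have im: "f ` (W - {q}) = {..<k}" using f by (simp add: bij_betw_def)
  \<comment> \<open>Transitivity through \<open>q\<close> puts every point below \<open>q\<close>
    under every point above \<open>q\<close>.\<close>
  have LU: "b - a \<in> D \<and> a < b" if ab: "a \<in> L" "b \<in> U" for a b
  proof -
    obtain v w where vw: "a = f v" "b = f w" "v \<in> lower s W q" "w \<in> upper s W q"
      using ab unfolding L_def U_def by blast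
    then have "(v, q) \<in> s" "(q, w) \<in> s" "v \<noteq> q" "w \<noteq> q"
      by (auto simp: lower_def upper_def)
    then have "(v, w) \<in> s" "v \<noteq> w" using tr asym by (auto dest: transD antisymD)
    moreover have "v \<in> W - {q}" "w \<in> W - {q}" using vw subL subU by blast+
    moreover have "f v \<noteq> f w" using calculation f by (auto simp: bij_betw_def inj_on_eq_iff)
    ultimately show ?thesis using o[of v w] vw by (auto simp: gap_def)
  qed
  have Lk: "L \<subseteq> {..<k}" and Uk: "U \<subseteq> {..<k}" using im subL subU
    unfolding L_def U_def by blast+
  define x0 where "x0 = f x"
  have x0: "x0 \<in> L" "x0 < k" using x(1) Lk unfolding x0_def L_def by auto
  \<comment> \<open>\<open>LU\<close> confines \<open>U\<close> to the upper set of
    \<open>x0\<close>, and the choice of \<open>x\<close> makes the sizes agree.\<close>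
  have U: "U = (\<lambda>d. x0 + d) ` (D \<inter> {..<k - x0})"
  proof (rule card_subset_eq)
    show "U \<subseteq> (\<lambda>d. x0 + d) ` (D \<inter> {..<k - x0})"
    proof
      fix b assume b: "b \<in> U"
      then have "b - x0 \<in> D" "x0 < b" "b < k" using LU[OF x0(1)] Uk by auto
      then show "b \<in> (\<lambda>d. x0 + d) ` (D \<inter> {..<k - x0})"
        by (intro image_eqI[of _ _ "b - x0"]) auto
    qed
    have "card ((\<lambda>d. x0 + d) ` (D \<inter> {..<k - x0})) = card (D \<inter> {..<k - x0})"
      by (rule card_image) simp
    then show "card U = card ((\<lambda>d. x0 + d) ` (D \<inter> {..<k - x0}))" using x2 cardU
      by (simp add: x0_def)
  qed (use finD in simp)
  define d1 where "d1 = Min D"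
  have "U \<noteq> {}" using y(1) by (auto simp: U_def)
  then obtain d where d: "d \<in> D" "d < k - x0" unfolding U by auto
  have "Min D \<in> D" using finD d(1) by (intro Min_in) auto
  then have d1: "d1 \<in> D" "\<And>e. e \<in> D \<Longrightarrow> d1 \<le> e" using finD
    by (auto simp: d1_def)
  have d1k: "d1 < k - x0" using d1(2)[OF d(1)] d(2) by simp
  define X where "X = x0 + d1"
  have X: "X \<in> U" "X < k" unfolding U X_def using d1(1) d1k by auto
  \<comment> \<open>\<open>X\<close> is the least element of \<open>U\<close>, hence at most
    \<open>f y\<close>. So the choice of \<open>y\<close> bounds
    \<open>card (D \<inter> {..X})\<close> by \<open>card L\<close>; the reverse bound comes from
    \<open>LU\<close> at \<open>X\<close>.\<close>
  have L: "L = (\<lambda>d. X - d) ` (D \<inter> {..X})" and card_X: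
    "card (D \<inter> {..X}) = card L"
  proof -
    have sub: "L \<subseteq> (\<lambda>d. X - d) ` (D \<inter> {..X})"
    proof
      fix a assume a: "a \<in> L"
      then have "X - a \<in> D" "a < X" using LU[OF a X(1)] by auto
      then show "a \<in> (\<lambda>d. X - d) ` (D \<inter> {..X})"
        by (intro image_eqI[of _ _ "X - a"]) auto
    qed
    have c: "card ((\<lambda>d. X - d) ` (D \<inter> {..X})) = card (D \<inter> {..X})"
      by (rule card_image) (auto simp: inj_on_def)
    have "f y \<in> U" using y(1) by (simp add: U_def)
    then have "X \<le> f y" unfolding U X_def using d1(2) by auto
    then have "card (D \<inter> {..X}) \<le> card (D \<inter> {..f y})" using finD
      by (intro card_mono) auto
    moreover have "card L \<le> card (D \<inter> {..X})" using card_mono[OF _ sub] finD c by simp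
    ultimately show eq: "card (D \<inter> {..X}) = card L" using y2 cardL by simp
    show "L = (\<lambda>d. X - d) ` (D \<inter> {..X})"
      by (rule card_subset_eq) (use sub finD c eq in auto)
  qed
  have cardU': "card (D \<inter> {..<k - x0}) = card U" using x2 cardU by (simp add: x0_def)
  \<comment> \<open>This is the difference between the coordinate \<open>x0 + e\<close> of a point
    above \<open>q\<close> and the coordinate \<open>X - d\<close> of a point below
    \<open>q\<close>.\<close>
  have diff: "d + e - d1 \<in> D" if "d \<in> D" "d \<le> X" "e \<in> D" "e < k - x0" for d e
  proof -
    have "X - d \<in> L" "x0 + e \<in> U" unfolding L U using that by auto
    then have "x0 + e - (X - d) \<in> D" using LU by blast
    moreover have "x0 + e - (X - d) = d + e - d1"
      using that d1(2)[OF that(1)] unfolding X_def by simp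
    ultimately show ?thesis by simp
  qed
  have "D \<inter> {..X} \<noteq> {}" using d1(1) X_def by auto
  then have t: "Max (D \<inter> {..X}) \<in> D \<inter> {..X}" using finD by (intro Max_in) auto
  have "D \<inter> {..<k - x0} \<noteq> {}" using d by auto
  then have p: "Max (D \<inter> {..<k - x0}) \<in> D \<inter> {..<k - x0}" using finD
    by (intro Max_in) auto
  define t p where "t = Max (D \<inter> {..X})" and "p = Max (D \<inter> {..<k - x0})"
  have t: "t \<in> D" "t \<le> X"
    "\<And>e. e \<in> D \<Longrightarrow> e \<le> X \<Longrightarrow> e \<le> t"
    using t finD unfolding t_def by auto
  have p: "p \<in> D" "p < k - x0"
    "\<And>e. e \<in> D \<Longrightarrow> e < k - x0 \<Longrightarrow> e \<le> p"
    using p finD unfolding p_def by auto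
  have Dt: "D \<inter> {..X} = D \<inter> {..t}" using t by auto
  have Dp: "D \<inter> {..<k - x0} = D \<inter> {..p}" using p by auto
  have "t + p \<le> k"
  proof (rule ccontr)
    assume "\<not> t + p \<le> k"
    \<comment> \<open>\<open>k - p\<close> lies strictly between \<open>x0\<close> and
      \<open>X\<close>, while \<open>L\<close> lies at or below \<open>x0\<close> and
      \<open>U\<close> at or above \<open>X\<close>; so the point there is incomparable to
      \<open>q\<close>.\<close>
    then have z0: "x0 < k - p" "k - p < t" using p(2) by auto
    then have "k - p \<in> f ` (W - {q})" using im t(2) X(2) by auto
    then obtain z where z: "z \<in> W - {q}" "f z = k - p" by (metis imageE)
    have "k - p \<notin> L"
    proof
      assume "k - p \<in> L"
      then obtain d where "d \<in> D" "k - p = X - d" unfolding L by auto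
      then have "k - p \<le> x0" using d1(2)[of d] by (simp add: X_def)
      then show False using z0 by simp
    qed
    then have "z \<notin> lower s W q" unfolding L_def z(2)[symmetric] by blast
    have "k - p \<notin> U"
    proof
      assume "k - p \<in> U"
      then obtain d where "d \<in> D" "k - p = x0 + d" unfolding U by auto
      then have "k - p \<ge> X" using d1(2)[of d] by (simp add: X_def)
      then show False using z0 t(2) by simp
    qed
    then have "z \<notin> upper s W q" unfolding U_def z(2)[symmetric] by blast
    have "card (lower s W z) = card (D \<inter> {..k - p})"
      using card_lower_one_point_extension[OF fin q D0 f o z(1)] z(2) \<open>z \<notin> upper s W q\<close> by simp
    also have "\<dots> < card (D \<inter> {..X})"
    proof (rule psubset_card_mono)
      have "t \<in> D \<inter> {..X}" "t \<notin> D \<inter> {..k - p}" using t(1,2) z0(2) by auto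
      moreover have "k - p \<le> X" using z0(2) t(2) by simp
      ultimately show "D \<inter> {..k - p} \<subset> D \<inter> {..X}" by auto
    qed (use finD in simp)
    finally have less: "card (lower s W z) < card (lower s W q)" using card_X cardL by simp
    have "card (upper s W z) = card (D \<inter> {..<k - (k - p)})"
      using card_upper_one_point_extension[OF fin q D0 f o z(1)] z(2) \<open>z \<notin> lower s W q\<close> by simp
    also have "\<dots> < card (D \<inter> {..<k - x0})"
    proof (rule psubset_card_mono)
      show "D \<inter> {..<k - (k - p)} \<subset> D \<inter> {..<k - x0}" using p by auto
    qed (use finD in simp)
    finally have "card (upper s W z) < card (upper s W q)" using cardU' cardU by simp
    then show False using anti[OF _ q less] z(1) by simp
  qed
  have split: "card D = card (D \<inter> {..v}) + card (D \<inter> {v<..})" for v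
  proof -
    have "D = (D \<inter> {..v}) \<union> (D \<inter> {v<..})" by auto
    then have "card D = card ((D \<inter> {..v}) \<union> (D \<inter> {v<..}))" by simp
    also have "\<dots> = card (D \<inter> {..v}) + card (D \<inter> {v<..})"
      by (rule card_Un_disjoint) (use finD in auto)
    finally show ?thesis .
  qed
  \<comment> \<open>By \<open>deg\<close>, \<open>D\<close> has as many elements above
    \<open>t\<close> as up to \<open>p\<close>, and closure under sums supplies that many of the
    form \<open>t + e\<close>.\<close>
  have above_t: "(\<lambda>e. t + e) ` (D \<inter> {..p}) = D \<inter> {t<..}"
  proof (rule card_subset_eq)
    show "(\<lambda>e. t + e) ` (D \<inter> {..p}) \<subseteq> D \<inter> {t<..}"
      using closed t(1) \<open>t + p \<le> k\<close> D by auto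
    have "card ((\<lambda>e. t + e) ` (D \<inter> {..p})) = card (D \<inter> {..p})"
      by (rule card_image) simp
    then show "card ((\<lambda>e. t + e) ` (D \<inter> {..p})) = card (D \<inter> {t<..})"
      using split[of t] deg card_X cardU' cardL cardU Dt Dp by simp
  qed (use finD in simp)
  have above_p: "(\<lambda>e. p + e) ` (D \<inter> {..t}) = D \<inter> {p<..}"
  proof (rule card_subset_eq)
    show "(\<lambda>e. p + e) ` (D \<inter> {..t}) \<subseteq> D \<inter> {p<..}"
      using closed p(1) \<open>t + p \<le> k\<close> D by (auto simp: add.commute)
    have "card ((\<lambda>e. p + e) ` (D \<inter> {..t})) = card (D \<inter> {..t})"
      by (rule card_image) simp
    then show "card ((\<lambda>e. p + e) ` (D \<inter> {..t})) = card (D \<inter> {p<..})"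
      using split[of p] deg card_X cardU' cardL cardU Dt Dp by simp
  qed (use finD in simp)
  have below_p: "d1 dvd e" if "e \<in> D" "e \<le> p" for e
    using that
  proof (induction e rule: less_induct)
    case (less e)
    show ?case
    proof (cases "e = d1")
      case False
      then have "d1 < e" using d1(2)[OF less.prems(1)] by simp
      \<comment> \<open>An element of \<open>D\<close> above \<open>t\<close> has the form
        \<open>t + e'\<close> with \<open>e'\<close> in \<open>D\<close>; here
        \<open>e' = e - d1\<close>, so the induction can descend.\<close>
      have "t + e - d1 \<in> D \<inter> {t<..}"
        using diff[OF t(1,2) less.prems(1)] less.prems(2) p(2) \<open>d1 < e\<close> by auto
      then obtain e' where "t + e - d1 = t + e'" "e' \<in> D" unfolding above_t[symmetric] by auto
      then have "e - d1 \<in> D" using \<open>d1 < e\<close>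
        by (metis Nat.add_diff_assoc add_left_cancel less_imp_le)
      moreover have "d1 > 0" using d1(1) D0 by (metis gr0I)
      ultimately have "d1 dvd e - d1" using less \<open>d1 < e\<close> by auto
      then show ?thesis using \<open>d1 < e\<close>
        by (metis dvd_add_triv_right_iff le_add_diff_inverse2 less_imp_le)
    qed simp
  qed
  have below_t: "d1 dvd e" if "e \<in> D" "e \<le> t" for e
    using that
  proof (induction e rule: less_induct)
    case (less e)
    show ?case
    proof (cases "e = d1")
      case False
      then have "d1 < e" using d1(2)[OF less.prems(1)] by simp
      have "p + e - d1 \<in> D \<inter> {p<..}"
        using diff[OF less.prems(1) _ p(1,2)] less.prems(2) t(2) \<open>d1 < e\<close>
          by (auto simp: add.commute)
      then obtain e' where "p + e - d1 = p + e'" "e' \<in> D" unfolding above_p[symmetric] by auto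
      then have "e - d1 \<in> D" using \<open>d1 < e\<close>
        by (metis Nat.add_diff_assoc add_left_cancel less_imp_le)
      moreover have "d1 > 0" using d1(1) D0 by (metis gr0I)
      ultimately have "d1 dvd e - d1" using less \<open>d1 < e\<close> by auto
      then show ?thesis using \<open>d1 < e\<close>
        by (metis dvd_add_triv_right_iff le_add_diff_inverse2 less_imp_le)
    qed simp
  qed
  have "d1 dvd e" if "e \<in> D" for e
  proof (cases "e \<le> t")
    case False
    then have "e \<in> (\<lambda>e. t + e) ` (D \<inter> {..p})" using that above_t by simp
    then obtain e' where "e = t + e'" "e' \<in> D" "e' \<le> p" by blast
    then show ?thesis using below_t[OF t(1)] below_p by simp
  qed (use below_t that in blast)
  then show ?thesis using d1(1) by blast
qed

section \<open>Two minimal points and the displacement of coordinates\<close>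

lemma harmonic_imp_eq_on_neighbours:
  fixes h :: "'a \<Rightarrow> int"
  assumes fin: "finite V" and sub: "\<And>x. x \<in> V \<Longrightarrow> N x \<subseteq> V"
    and sym: "\<And>x y. x \<in> V \<Longrightarrow> y \<in> V \<Longrightarrow> y \<in> N x \<longleftrightarrow> x \<in> N y"
    and harm: "\<And>x. x \<in> V \<Longrightarrow> (\<Sum>y\<in>N x. h y) = int (card (N x)) * h x"
    and xy: "x \<in> V" "y \<in> N x"
  shows "h y = h x"
proof -
  have finN: "finite (N x)" if "x \<in> V" for x using sub[OF that] fin by (rule finite_subset)
  have restr: "(\<Sum>y | y \<in> V \<and> y \<in> N x. g y) = (\<Sum>y\<in>N x. g y)"
    if "x \<in> V" for x and g :: "'a \<Rightarrow> int"
    using sub[OF that] by (intro sum.cong) auto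
  \<comment> \<open>The sum of the squared differences over all neighbouring pairs vanishes:
    symmetry of \<open>N\<close> balances the pure squares, and harmonicity evaluates the mixed
    terms.\<close>
  have "(\<Sum>x\<in>V. \<Sum>y\<in>N x. (h y)\<^sup>2) = (\<Sum>x\<in>V. \<Sum>y | y \<in> V \<and> y \<in> N x. (h y)\<^sup>2)"
    by (simp add: restr)
  also have "\<dots> = (\<Sum>y\<in>V. \<Sum>x | x \<in> V \<and> y \<in> N x. (h y)\<^sup>2)"
    by (rule sum.swap_restrict[OF fin fin])
  also have "\<dots> = (\<Sum>y\<in>V. int (card (N y)) * (h y)\<^sup>2)"
  proof (rule sum.cong[OF refl])
    fix y assume y: "y \<in> V"
    then have "{x. x \<in> V \<and> y \<in> N x} = N y" using sym sub by blast
    then show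
      "(\<Sum>x | x \<in> V \<and> y \<in> N x. (h y)\<^sup>2) = int (card (N y)) * (h y)\<^sup>2"
        by simp
  qed
  finally have squares: "(\<Sum>x\<in>V. \<Sum>y\<in>N x. (h y)\<^sup>2) = (\<Sum>x\<in>V. int (card (N x)) * (h x)\<^sup>2)" .
  have "(\<Sum>y\<in>N x. (h y - h x)\<^sup>2) = (\<Sum>y\<in>N x. (h y)\<^sup>2) - int (card (N x)) * (h x)\<^sup>2" if "x \<in> V" for x
  proof -
    have "(\<Sum>y\<in>N x. (h y - h x)\<^sup>2) = (\<Sum>y\<in>N x. (h y)\<^sup>2) - 2 * h x * (\<Sum>y\<in>N x. h y) + int (card (N x)) * (h x)\<^sup>2"
      by (simp add: power2_diff sum.distrib sum_subtractf sum_distrib_left sum_distrib_right algebra_simps)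
    then show ?thesis using harm[OF that] by (simp add: power2_eq_square algebra_simps)
  qed
  then have "(\<Sum>x\<in>V. \<Sum>y\<in>N x. (h y - h x)\<^sup>2) = 0" using squares
    by (simp add: sum_subtractf)
  then have "(\<Sum>y\<in>N x. (h y - h x)\<^sup>2) = 0"
    using fin xy(1) by (subst (asm) sum_nonneg_eq_0_iff) (auto intro: sum_nonneg)
  then show ?thesis using finN[OF xy(1)] xy(2) by (subst (asm) sum_nonneg_eq_0_iff) auto
qed

text \<open>The up degree of \<open>q\<close> is \<open>card D\<close>, so \<open>g z - g q\<close>
  runs through all of \<open>D\<close> as \<open>z\<close> runs through the points above
  \<open>q\<close>. The number of elements of \<open>D\<close> up to \<open>g z - g q\<close> bounds
  the down degree of \<open>z\<close> from below, and by \<open>sum\<close> these bounds have the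
  right total, so each is sharp.\<close>

lemma minimal_extension_ladder:
  assumes fin: "finite W" and q: "q \<in> W" "q' \<in> W" "q \<noteq> q'"
    and min: "lower s W q' = {}" and D: "D \<subseteq> {1..k}"
    and g: "bij_betw g (W - {q'}) {..<k}"
    and o: "\<And>x y. x \<in> W - {q'} \<Longrightarrow> y \<in> W - {q'} \<Longrightarrow> (x, y) \<in> s \<longleftrightarrow> (g x, g y) \<in> gap D"
    and deg: "card (upper s W q) = card D"
    and sum: "(\<Sum>z\<in>upper s W q. card (lower s W z)) = (\<Sum>d\<in>D. card (D \<inter> {..d}))"
    and z: "z \<in> upper s W q"
  shows "z \<notin> upper s W q'" "g z - g q \<in> D"
    "card (D \<inter> {..g z}) = card (D \<inter> {..g z - g q})"
proof -
  have D0: "0 \<notin> D" and finD: "finite D" using D finite_subset by auto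
  have sub: "upper s W q \<subseteq> W - {q'}" using min q by (auto simp: upper_def lower_def)
  have up: "upper s (W - {q'}) q = upper s W q" using sub by (auto simp: upper_def)
  have gq: "g q < k" using bij_betwE[OF g] q by blast
  have im: "g ` upper s W q = (\<lambda>d. g q + d) ` (D \<inter> {..<k - g q})"
    using bij_betw_upper[of g "W - {q'}" "{..<k}" s "gap D" q, OF g o] q up upper_gap[OF D0 gq]
      by simp
  have "card (g ` upper s W q) = card D" using card_image_subset[OF g sub] deg by simp
  moreover have
    "card ((\<lambda>d. g q + d) ` (D \<inter> {..<k - g q})) = card (D \<inter> {..<k - g q})"
    by (rule card_image) simp
  ultimately have "D \<inter> {..<k - g q} = D" using im finD by (intro card_subset_eq) auto
  then have im: "g ` upper s W q = (\<lambda>d. g q + d) ` D" using im by simp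
  have inj: "inj_on g (upper s W q)" using g sub by (meson bij_betw_imp_inj_on inj_on_subset)
  have "bij_betw (\<lambda>z. g z - g q) (upper s W q) D"
  proof (rule bij_betw_imageI)
    have "g q \<le> g z" if "z \<in> upper s W q" for z
    proof -
      have "g z \<in> (\<lambda>d. g q + d) ` D" using im that by blast
      then show ?thesis by auto
    qed
    then show "inj_on (\<lambda>z. g z - g q) (upper s W q)"
      using inj by (auto simp: inj_on_def) (metis le_add_diff_inverse2)
    have "(\<lambda>z. g z - g q) ` upper s W q = (\<lambda>v. v - g q) ` (g ` upper s W q)"
      by (simp add: image_image)
    then show "(\<lambda>z. g z - g q) ` upper s W q = D" unfolding im by (simp add: image_image)
  qed
  note bij = this
  show gz: "g z - g q \<in> D" using bij_betwE[OF bij] z by blast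
  have "(\<Sum>z\<in>upper s W q. card (D \<inter> {..g z - g q})) = (\<Sum>d\<in>D. card (D \<inter> {..d}))"
    by (rule sum.reindex_bij_betw[OF bij])
  then have eq:
    "(\<Sum>z\<in>upper s W q. card (D \<inter> {..g z - g q})) = (\<Sum>z\<in>upper s W q. card (lower s W z))"
    using sum by simp
  have low: "card (lower s W z) = card (D \<inter> {..g z}) + of_bool (z \<in> upper s W q')"
    if "z \<in> upper s W q" for z
    by (rule card_lower_one_point_extension[OF fin q(2) D0 g o]) (use that sub in auto)
  have le: "card (D \<inter> {..g z - g q}) \<le> card (D \<inter> {..g z})" for z
    using finD by (intro card_mono) auto
  have "card (D \<inter> {..g z - g q}) = card (lower s W z)"
  proof (rule sum_mono_inv[OF eq _ z])
    show "finite (upper s W q)" using fin by (simp add: upper_def)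
    show "card (D \<inter> {..g i - g q}) \<le> card (lower s W i)" if "i \<in> upper s W q" for i
      using low[OF that] le[of i] by simp
  qed
  \<comment> \<open>Sharpness excludes both a relation from \<open>q'\<close> to \<open>z\<close>
    and elements of \<open>D\<close> in the range from \<open>g z - g q\<close> (exclusive) to
    \<open>g z\<close>.\<close>
  then have *:
    "card (D \<inter> {..g z - g q}) = card (D \<inter> {..g z}) + of_bool (z \<in> upper s W q')"
    using low[OF z] by simp
  then show "z \<notin> upper s W q'" "card (D \<inter> {..g z}) = card (D \<inter> {..g z - g q})"
    using le[of z] by (auto split: if_splits)
qed

text \<open>By the preceding lemma, the distance \<open>d\<close> from \<open>q\<close> up to
  \<open>z\<close> in the coordinate \<open>g\<close> is the largest element of \<open>D\<close> up
  to \<open>g z\<close>. Deleting \<open>q\<close> instead of \<open>q'\<close> loses just this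
  distance: the coordinate of \<open>z\<close> drops below \<open>d\<close>, and the other points
  below \<open>z\<close> occupy the same set \<open>E\<close> of distances in both
  coordinates.\<close>

lemma minimal_extension_shift:
  assumes fin: "finite W" and q: "q \<in> W" "q' \<in> W" "q \<noteq> q'"
    and min: "lower s W q = {}" "lower s W q' = {}" and D: "D \<subseteq> {1..k}"
    and f: "bij_betw f (W - {q}) {..<k}"
    and fo: "\<And>x y. x \<in> W - {q} \<Longrightarrow> y \<in> W - {q} \<Longrightarrow> (x, y) \<in> s \<longleftrightarrow> (f x, f y) \<in> gap D"
    and g: "bij_betw g (W - {q'}) {..<k}"
    and go: "\<And>x y. x \<in> W - {q'} \<Longrightarrow> y \<in> W - {q'} \<Longrightarrow> (x, y) \<in> s \<longleftrightarrow> (g x, g y) \<in> gap D"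
    and deg: "card (upper s W q) = card D"
    and sum: "(\<Sum>z\<in>upper s W q. card (lower s W z)) = (\<Sum>d\<in>D. card (D \<inter> {..d}))"
    and z: "z \<in> upper s W q"
  shows "f z < g z"
    and "\<exists>E. E \<subseteq> {..f z} \<and> E \<subseteq> {..g z} \<and> f ` (lower s W z - {q, q'}) = (\<lambda>d. f z - d) ` E \<and>
      g ` (lower s W z - {q, q'}) = (\<lambda>d. g z - d) ` E"
proof -
  have D0: "0 \<notin> D" and finD: "finite D" using D finite_subset by auto
  note lad = minimal_extension_ladder[OF fin q min(2) D g go deg sum z]
  have zW: "z \<in> W - {q}" "z \<in> W - {q'}" using z min q by (auto simp: upper_def lower_def)
  have "f z < k" "g z < k" using bij_betwE[OF f] bij_betwE[OF g] zW by blast+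
  define d where "d = g z - g q"
  have d: "d \<in> D" "d \<le> g z" "g q = g z - d" using lad(2) D0 unfolding d_def
    by (auto, metis diff_diff_cancel diff_is_0_eq' linorder_le_cases)
  have gd: "D \<inter> {..g z} = D \<inter> {..d}"
  proof (rule sym, rule card_subset_eq)
    show "D \<inter> {..d} \<subseteq> D \<inter> {..g z}" using d(2) by auto
    show "card (D \<inter> {..d}) = card (D \<inter> {..g z})" unfolding d_def
      by (rule lad(3)[symmetric])
  qed (use finD in simp)
  have c: "card (D \<inter> {..g z}) = Suc (card (D \<inter> {..f z}))"
    using card_lower_one_point_extension[OF fin q(1) D0 f fo zW(1)]
      card_lower_one_point_extension[OF fin q(2) D0 g go zW(2)] z lad(1) by simp
  show less: "f z < g z"
  proof (rule ccontr)
    assume "\<not> f z < g z"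
    then have "card (D \<inter> {..g z}) \<le> card (D \<inter> {..f z})" using finD
      by (intro card_mono) auto
    then show False using c by simp
  qed
  have "f z < d"
  proof (rule ccontr)
    assume "\<not> f z < d"
    then have "card (D \<inter> {..d}) \<le> card (D \<inter> {..f z})" using finD
      by (intro card_mono) auto
    then show False using c gd by simp
  qed
  have fE: "D \<inter> {..f z} = D \<inter> {..g z} - {d}"
  proof (rule card_subset_eq)
    show "D \<inter> {..f z} \<subseteq> D \<inter> {..g z} - {d}" using \<open>f z < d\<close> less
      by auto
    show "card (D \<inter> {..f z}) = card (D \<inter> {..g z} - {d})" using c d by simp
  qed (use finD in simp)
  let ?N = "lower s W z - {q, q'}"
  have N: "lower s (W - {q}) z = ?N" "lower s (W - {q'}) z = insert q ?N" "q \<notin> ?N"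
    using z lad(1) q by (auto simp: lower_def upper_def)
  have "f ` ?N = (\<lambda>d. f z - d) ` (D \<inter> {..f z})"
    using bij_betw_lower[of f "W - {q}" "{..<k}" s "gap D" z, OF f fo zW(1)] N(1)
      lower_gap[OF D0 \<open>f z < k\<close>] by simp
  moreover have "g ` ?N = (\<lambda>d. g z - d) ` (D \<inter> {..f z})"
  proof -
    have "inj_on g (insert q ?N)"
      using g N(2) lower_subset[of s "W - {q'}" z] by (metis bij_betw_imp_inj_on inj_on_subset)
    then have "g ` (insert q ?N - {q}) = g ` insert q ?N - g ` {q}"
      by (rule inj_on_image_set_diff) auto
    moreover have "insert q ?N - {q} = ?N" using N(3) by (rule Diff_insert_absorb)
    ultimately have "g ` ?N = g ` insert q ?N - {g q}" by (simp only: image_insert image_empty)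
    also have "g ` insert q ?N = (\<lambda>d. g z - d) ` (D \<inter> {..g z})"
      using bij_betw_lower[of g "W - {q'}" "{..<k}" s "gap D" z, OF g go zW(2)] N(2)
        lower_gap[OF D0 \<open>g z < k\<close>] by simp
    also have "(\<lambda>d. g z - d) ` (D \<inter> {..g z}) - {g q} = (\<lambda>d. g z - d) ` (D \<inter> {..g z} - {d})"
    proof -
      have "inj_on (\<lambda>d. g z - d) {..g z}" by (auto simp: inj_on_def)
      then have
        "(\<lambda>d. g z - d) ` (D \<inter> {..g z} - {d}) = (\<lambda>d. g z - d) ` (D \<inter> {..g z}) - (\<lambda>d. g z - d) ` {d}"
        by (rule inj_on_image_set_diff) (use d(2) in auto)
      then show ?thesis using d(3) by (simp only: image_insert image_empty)
    qed
    finally show ?thesis using fE by simp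
  qed
  ultimately show
    "\<exists>E. E \<subseteq> {..f z} \<and> E \<subseteq> {..g z} \<and> f ` ?N = (\<lambda>d. f z - d) ` E \<and> g ` ?N = (\<lambda>d. g z - d) ` E"
    using less by (intro exI[of _ "D \<inter> {..f z}"]) auto
qed

text \<open>\<open>f\<close> and \<open>g\<close> may assign different parameters \<open>e\<close>
  to the same point; only the sums over the images are compared.\<close>

lemma sum_diff_if_images_translated:
  fixes f g :: "'a \<Rightarrow> nat" and F G :: "nat \<Rightarrow> nat"
  assumes "inj_on f N" "inj_on g N" "f ` N = F ` E" "g ` N = G ` E" "inj_on F E" "inj_on G E"
    and c: "\<And>e. e \<in> E \<Longrightarrow> int (G e) - int (F e) = c"
  shows "(\<Sum>x\<in>N. int (g x) - int (f x)) = int (card N) * c"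
proof -
  have "(\<Sum>x\<in>N. int (f x)) = (\<Sum>e\<in>E. int (F e))"
    using sum.reindex[OF assms(1), of int] sum.reindex[OF assms(5), of int] assms(3) by simp
  moreover have "(\<Sum>x\<in>N. int (g x)) = (\<Sum>e\<in>E. int (G e))"
    using sum.reindex[OF assms(2), of int] sum.reindex[OF assms(6), of int] assms(4) by simp
  moreover have "card N = card E" using assms(1,3,5) by (metis card_image)
  moreover have "(\<Sum>e\<in>E. int (G e) - int (F e)) = int (card E) * c" using c by simp
  ultimately show ?thesis by (simp add: sum_subtractf)
qed

text \<open>
  The displacement between the two coordinate functions is harmonic on the complement of the
  two points, positive above the one and negative above the other.
\<close>

lemma two_minimal_points_not_connected_on:
  assumes fin: "finite W" and asym: "antisym s" and q: "q \<in> W" "q' \<in> W" "q \<noteq> q'"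
    and min: "lower s W q = {}" "lower s W q' = {}" and D: "D \<subseteq> {1..k}"
    and iso: "iso_on s (W - {q}) (gap D) {..<k}" "iso_on s (W - {q'}) (gap D) {..<k}"
    and deg: "card (upper s W q) = card D" "card (upper s W q') = card D"
    and sum: "(\<Sum>z\<in>upper s W q. card (lower s W z)) = (\<Sum>d\<in>D. card (D \<inter> {..d}))"
      "(\<Sum>z\<in>upper s W q'. card (lower s W z)) = (\<Sum>d\<in>D. card (D \<inter> {..d}))"
  shows "\<not> connected_on s W"
proof
  assume con: "connected_on s W"
  obtain f where f: "bij_betw f (W - {q}) {..<k}"
    and fo: "\<And>x y. x \<in> W - {q} \<Longrightarrow> y \<in> W - {q} \<Longrightarrow> (x, y) \<in> s \<longleftrightarrow> (f x, f y) \<in> gap D"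
    using iso(1) unfolding iso_on_def by blast
  obtain g where g: "bij_betw g (W - {q'}) {..<k}"
    and go: "\<And>x y. x \<in> W - {q'} \<Longrightarrow> y \<in> W - {q'} \<Longrightarrow> (x, y) \<in> s \<longleftrightarrow> (g x, g y) \<in> gap D"
    using iso(2) unfolding iso_on_def by blast
  have D0: "0 \<notin> D" and finD: "finite D" using D finite_subset by auto
  \<comment> \<open>\<open>shift\<close> makes the displacement positive above \<open>q\<close>;
    \<open>shift'\<close>, with the roles exchanged, makes it negative above
    \<open>q'\<close>.\<close>
  note shift = minimal_extension_shift[OF fin q min D f fo g go deg(1) sum(1)]
  note shift' = minimal_extension_shift[OF fin q(2,1) q(3)[symmetric] min(2,1) D g go f fo deg(2) sum(2)]
  let ?V = "W - {q, q'}" and ?h = "\<lambda>z. int (g z) - int (f z)"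
  let ?L = "\<lambda>z. lower s W z - {q, q'}"
  have injf: "inj_on f X" if "X \<subseteq> ?V" for X
    by (rule inj_on_subset[OF bij_betw_imp_inj_on[OF f]]) (use that in auto)
  have injg: "inj_on g X" if "X \<subseteq> ?V" for X
    by (rule inj_on_subset[OF bij_betw_imp_inj_on[OF g]]) (use that in auto)
  have subL: "?L z \<subseteq> ?V" for z by (auto simp: lower_def)
  have subU: "upper s W z \<subseteq> ?V" if "z \<in> W" for z using min q that
    by (auto simp: upper_def lower_def)
  have finL: "finite (?L z)" "finite (upper s W z)" for z using fin
    by (auto simp: lower_def upper_def)
  \<comment> \<open>The points above \<open>z\<close> survive in both cards because \<open>q\<close>
    and \<open>q'\<close> are minimal. Equal up degrees select the same part of \<open>D\<close>, so
    the coordinate sets are translates of each other.\<close>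
  have sumU: "(\<Sum>y\<in>upper s W z. ?h y) = int (card (upper s W z)) * ?h z"
    if z: "z \<in> ?V" for z
  proof -
    have zW: "z \<in> W - {q}" "z \<in> W - {q'}" "f z < k" "g z < k"
      using z bij_betwE[OF f] bij_betwE[OF g] by auto
    have sub: "upper s W z \<subseteq> ?V" using subU z by simp
    then have up: "upper s (W - {q}) z = upper s W z" "upper s (W - {q'}) z = upper s W z"
      by (auto simp: upper_def)
    have imf: "f ` upper s W z = (\<lambda>d. f z + d) ` (D \<inter> {..<k - f z})"
      using bij_betw_upper[of f "W - {q}" "{..<k}" s "gap D" z, OF f fo zW(1)] up
        upper_gap[OF D0 zW(3)] by simp
    have img: "g ` upper s W z = (\<lambda>d. g z + d) ` (D \<inter> {..<k - g z})"
      using bij_betw_upper[of g "W - {q'}" "{..<k}" s "gap D" z, OF g go zW(2)] up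
        upper_gap[OF D0 zW(4)] by simp
    have "card (D \<inter> {..<k - f z}) = card (upper s W z)"
      using arg_cong[OF imf, of card] card_image[OF injf[OF sub]] by (simp add: card_image)
    moreover have "card (D \<inter> {..<k - g z}) = card (upper s W z)"
      using arg_cong[OF img, of card] card_image[OF injg[OF sub]] by (simp add: card_image)
    moreover have
      "D \<inter> {..<k - f z} \<subseteq> D \<inter> {..<k - g z} \<or> D \<inter> {..<k - g z} \<subseteq> D \<inter> {..<k - f z}"
      by (cases "f z \<le> g z") auto
    ultimately have eq: "D \<inter> {..<k - f z} = D \<inter> {..<k - g z}"
      using finD by (metis card_subset_eq finite_Int)
    show ?thesis
      by (rule sum_diff_if_images_translated[OF injf[OF sub] injg[OF sub] imf img[folded eq]]) auto
  qed
  \<comment> \<open>For a point above \<open>q\<close> or \<open>q'\<close> the common distances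
    come from the preceding shift lemma; for any other point they come from equal down
    degrees.\<close>
  have sumL: "(\<Sum>y\<in>?L z. ?h y) = int (card (?L z)) * ?h z" if z: "z \<in> ?V" for z
  proof -
    have "\<exists>E. E \<subseteq> {..f z} \<and> E \<subseteq> {..g z} \<and> f ` ?L z = (\<lambda>d. f z - d) ` E \<and> g ` ?L z = (\<lambda>d. g z - d) ` E"
    proof -
      consider "z \<in> upper s W q" | "z \<in> upper s W q'" | "z \<notin> upper s W q" "z \<notin> upper s W q'" by blast
      then show ?thesis
      proof cases
        case 1
        then show ?thesis using shift(2) by simp
      next
        case 2
        then show ?thesis using shift'(2)[of z] by (auto simp: insert_commute)
      next
        case 3
        have zW: "z \<in> W - {q}" "z \<in> W - {q'}" "f z < k" "g z < k"
          using z bij_betwE[OF f] bij_betwE[OF g] by auto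
        have low: "lower s (W - {q}) z = ?L z" "lower s (W - {q'}) z = ?L z" "lower s W z = ?L z"
          using 3 z by (auto simp: lower_def upper_def)
        have imf: "f ` ?L z = (\<lambda>d. f z - d) ` (D \<inter> {..f z})"
          using bij_betw_lower[of f "W - {q}" "{..<k}" s "gap D" z, OF f fo zW(1)] low
            lower_gap[OF D0 zW(3)] by simp
        have img: "g ` ?L z = (\<lambda>d. g z - d) ` (D \<inter> {..g z})"
          using bij_betw_lower[of g "W - {q'}" "{..<k}" s "gap D" z, OF g go zW(2)] low
            lower_gap[OF D0 zW(4)] by simp
        have "card (D \<inter> {..f z}) = card (D \<inter> {..g z})"
          using card_lower_one_point_extension[OF fin q(1) D0 f fo zW(1)]
            card_lower_one_point_extension[OF fin q(2) D0 g go zW(2)] 3 by simp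
        moreover have
          "D \<inter> {..f z} \<subseteq> D \<inter> {..g z} \<or> D \<inter> {..g z} \<subseteq> D \<inter> {..f z}"
          by (cases "f z \<le> g z") auto
        ultimately have eq: "D \<inter> {..f z} = D \<inter> {..g z}"
          using finD by (metis card_subset_eq finite_Int)
        show ?thesis using imf img eq by (intro exI[of _ "D \<inter> {..f z}"]) auto
      qed
    qed
    then obtain E where E: "E \<subseteq> {..f z}" "E \<subseteq> {..g z}"
      "f ` ?L z = (\<lambda>d. f z - d) ` E" "g ` ?L z = (\<lambda>d. g z - d) ` E"
      by (elim exE conjE) (rule that)
    have le: "e \<le> f z" "e \<le> g z" if "e \<in> E" for e using E(1,2) that by auto
    have "inj_on (\<lambda>d. f z - d) E" "inj_on (\<lambda>d. g z - d) E"
      by (rule inj_onI, metis le diff_diff_cancel)+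
    then show ?thesis
    proof (rule sum_diff_if_images_translated[OF injf[OF subL] injg[OF subL] E(3,4)])
      fix e assume "e \<in> E"
      then show "int (g z - e) - int (f z - e) = int (g z) - int (f z)"
        using le by (simp add: of_nat_diff)
    qed
  qed
  have disj: "?L z \<inter> upper s W z = {}" for z
    using asym by (auto simp: lower_def upper_def dest: antisymD)
  have const: "?h y = ?h z" if "z \<in> ?V" "y \<in> ?L z \<union> upper s W z" for z y
  proof (rule harmonic_imp_eq_on_neighbours[of ?V "\<lambda>z. ?L z \<union> upper s W z"])
    show "finite ?V" using fin by simp
    fix x assume x: "x \<in> ?V"
    show "?L x \<union> upper s W x \<subseteq> ?V" using subL[of x] subU[of x] x by simp
    show "(\<Sum>y\<in>?L x \<union> upper s W x. ?h y) = int (card (?L x \<union> upper s W x)) * ?h x"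
      using sumU[OF x] sumL[OF x] disj finL
      by (simp add: sum.union_disjoint card_Un_disjoint distrib_right)
    fix y assume "y \<in> ?V"
    then show
      "y \<in> ?L x \<union> upper s W x \<longleftrightarrow> x \<in> ?L y \<union> upper s W y"
      using x by (auto simp: lower_def upper_def)
  qed (use that in auto)
  \<comment> \<open>The displacement keeps its sign along edges of \<open>?V\<close>, is positive
    next to \<open>q\<close> and negative next to \<open>q'\<close>. So \<open>?S\<close> is cut off
    from the rest, which contains \<open>q'\<close>.\<close>
  let ?S = "insert q {z \<in> ?V. f z < g z}"
  have "separated s ?S (W - ?S)" unfolding separated_def
  proof (intro ballI)
    fix x y assume x: "x \<in> ?S" and y: "y \<in> W - ?S"
    have no: "\<not> ((x, y) \<in> s \<or> (y, x) \<in> s)"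
    proof
      assume xy: "(x, y) \<in> s \<or> (y, x) \<in> s"
      have "x \<noteq> y" using x y by blast
      show False
      proof (cases "x = q")
        case True
        then have "y \<in> upper s W q" using xy y \<open>x \<noteq> y\<close> min(1) q
          by (auto simp: upper_def lower_def)
        then have "y \<in> ?V" "f y < g y" using subU[OF q(1)] shift(1)[of y] by auto
        then show False using y by simp
      next
        case False
        then have xV: "x \<in> ?V" "f x < g x" using x by auto
        show False
        proof (cases "y = q'")
          case True
          then have "x \<in> upper s W q'" using xy xV \<open>x \<noteq> y\<close> min(2) q
            by (auto simp: upper_def lower_def)
          then show False using shift'(1)[of x] xV(2) by simp
        next
          case False
          then have "y \<in> ?V" using y by auto
          moreover have "y \<in> ?L x \<union> upper s W x"
            using xy \<open>x \<noteq> y\<close> \<open>y \<in> ?V\<close>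
              by (auto simp: lower_def upper_def)
          ultimately have "f y < g y" using const[OF xV(1), of y] xV(2) by linarith
          then have "y \<in> ?S" using \<open>y \<in> ?V\<close> by simp
          then show False using y by simp
        qed
      qed
    qed
    then show "(x, y) \<notin> s \<and> (y, x) \<notin> s" by blast
  qed
  then have SW: "?S = W" using q by (intro connected_onD[OF con]) auto
  have "q' \<in> ?S" unfolding SW by (rule q(2))
  then show False using q(3) by auto
qed

section \<open>Reconstruction\<close>

text \<open>In a finite chain the down degree is the rank, and it serves as the isomorphism.\<close>

lemma total_imp_iso_on_le:
  assumes fin: "finite W" and refl: "\<And>x. x \<in> W \<Longrightarrow> (x, x) \<in> s" and
    "antisym s" "trans s"
    and total:
      "\<And>x y. x \<in> W \<Longrightarrow> y \<in> W \<Longrightarrow> (x, y) \<in> s \<or> (y, x) \<in> s"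
  shows "iso_on s W {(i, j). i \<le> j} {..<card W}"
proof -
  let ?f = "\<lambda>x. card (lower s W x)"
  have finl: "finite (lower s W x)" for x using fin by (simp add: lower_def)
  have less: "?f x < ?f y" if "x \<in> W" "y \<in> W" "(x, y) \<in> s" "x \<noteq> y" for x y
  proof (rule psubset_card_mono[OF finl])
    have "x \<in> lower s W y" "x \<notin> lower s W x" using that by (auto simp: lower_def)
    moreover have "lower s W x \<subseteq> lower s W y"
      using that assms(3,4) by (auto simp: lower_def dest: transD antisymD)
    ultimately show "lower s W x \<subset> lower s W y" by blast
  qed
  have iff: "(x, y) \<in> s \<longleftrightarrow> ?f x \<le> ?f y"
    if xy: "x \<in> W" "y \<in> W" for x y
  proof (cases "x = y")
    case False
    show ?thesis
    proof (cases "(x, y) \<in> s")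
      case True
      then show ?thesis using less[OF xy True False] by simp
    next
      case no: False
      then have "(y, x) \<in> s" using total[OF xy] by blast
      then have "?f y < ?f x" using less[OF xy(2,1)] False by blast
      then show ?thesis using no by simp
    qed
  qed (use refl xy in simp)
  have inj: "inj_on ?f W"
  proof (rule inj_onI)
    fix x y assume xy: "x \<in> W" "y \<in> W" "?f x = ?f y"
    then have "(x, y) \<in> s" "(y, x) \<in> s" using iff by simp_all
    then show "x = y" using \<open>antisym s\<close> by (auto dest: antisymD)
  qed
  have "?f x < card W" if "x \<in> W" for x
    by (rule psubset_card_mono[OF fin]) (use that in \<open>auto simp: lower_def\<close>)
  then have "?f ` W \<subseteq> {..<card W}" by auto
  then have "?f ` W = {..<card W}"
    using card_image[OF inj] by (intro card_subset_eq) auto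
  then show ?thesis using inj iff by (intro iso_onI[of ?f]) (auto simp: bij_betw_def)
qed

text \<open>Any two points survive together in the card of a third one.\<close>

lemma same_cards_total:
  assumes sc: "same_cards r A s B" and card: "card A \<ge> 3"
    and total:
      "\<And>x y. x \<in> A \<Longrightarrow> y \<in> A \<Longrightarrow> (x, y) \<in> r \<or> (y, x) \<in> r"
    and xy: "x \<in> B" "y \<in> B"
  shows "(x, y) \<in> s \<or> (y, x) \<in> s"
proof -
  obtain h where h: "bij_betw h A B"
    "\<And>x. x \<in> A \<Longrightarrow> iso_on r (A - {x}) s (B - {h x})"
    using sc unfolding same_cards_def by blast
  have "card {x, y} \<le> 2" by (cases "x = y") auto
  then have "card {x, y} < card B" using bij_betw_same_card[OF h(1)] card by linarith
  then have "\<not> B \<subseteq> {x, y}" using card_mono[of "{x, y}" B] by auto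
  then obtain z where z: "z \<in> B" "z \<noteq> x" "z \<noteq> y" by blast
  then obtain v where v: "v \<in> A" "h v = z" using h(1) by (metis bij_betw_imp_surj_on imageE)
  obtain f where f: "bij_betw f (A - {v}) (B - {z})"
    and o: "\<And>a b. a \<in> A - {v} \<Longrightarrow> b \<in> A - {v} \<Longrightarrow> (a, b) \<in> r \<longleftrightarrow> (f a, f b) \<in> s"
    using h(2)[OF v(1)] v(2) unfolding iso_on_def by blast
  have "x \<in> f ` (A - {v})" "y \<in> f ` (A - {v})" using f xy z by (auto simp: bij_betw_def)
  then obtain a b where "a \<in> A - {v}" "b \<in> A - {v}" "x = f a" "y = f b" by blast
  then show ?thesis using o[of a b] o[of b a] total[of a b] by auto
qed

text \<open>The down degrees \<open>card (D \<inter> {..i})\<close> are nondecreasing in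
  \<open>i\<close>, so their distribution determines them as a sequence, whose jumps are the
  elements of \<open>D\<close>.\<close>

lemma gap_determined:
  assumes D: "D \<subseteq> {1..k}" "E \<subseteq> {1..k}"
    and eq: "\<And>h :: nat \<Rightarrow> int. (\<Sum>i<Suc k. h (card (D \<inter> {..i}))) = (\<Sum>i<Suc k. h (card (E \<inter> {..i})))"
  shows "D = E"
proof -
  have fin: "finite D" "finite E" using D finite_subset by auto
  \<comment> \<open>For \<open>E\<close>, all of \<open>{i..k}\<close> reach the threshold
    \<open>card (E \<inter> {..i})\<close>. If \<open>D\<close> had fewer elements up to
    \<open>i\<close>, only indices beyond \<open>i\<close> could reach it for
    \<open>D\<close>.\<close>
  have le: "card (E \<inter> {..i}) \<le> card (D \<inter> {..i})" if i: "i \<le> k"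
    and eq: "\<And>t. card {i \<in> {..<Suc k}. t \<le> card (D \<inter> {..i})} = card {i \<in> {..<Suc k}. t \<le> card (E \<inter> {..i})}"
    and fin: "finite D" "finite E" for i and D E :: "nat set"
  proof (rule ccontr)
    assume "\<not> ?thesis"
    then have less: "card (D \<inter> {..i}) < card (E \<inter> {..i})" by simp
    let ?t = "card (E \<inter> {..i})"
    have "{j \<in> {..<Suc k}. ?t \<le> card (D \<inter> {..j})} \<subseteq> {Suc i..k}"
    proof
      fix j assume j: "j \<in> {j \<in> {..<Suc k}. ?t \<le> card (D \<inter> {..j})}"
      have "\<not> j \<le> i"
      proof
        assume "j \<le> i"
        then have "card (D \<inter> {..j}) \<le> card (D \<inter> {..i})" using fin
          by (intro card_mono) auto
        then show False using j less by auto
      qed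
      then show "j \<in> {Suc i..k}" using j by auto
    qed
    then have "card {j \<in> {..<Suc k}. ?t \<le> card (D \<inter> {..j})} \<le> card {Suc i..k}"
      by (intro card_mono) auto
    moreover have "{i..k} \<subseteq> {j \<in> {..<Suc k}. ?t \<le> card (E \<inter> {..j})}"
    proof
      fix j assume j: "j \<in> {i..k}"
      then have "?t \<le> card (E \<inter> {..j})" using fin by (intro card_mono) auto
      then show "j \<in> {j \<in> {..<Suc k}. ?t \<le> card (E \<inter> {..j})}" using j by simp
    qed
    then have "card {i..k} \<le> card {j \<in> {..<Suc k}. ?t \<le> card (E \<inter> {..j})}"
      by (intro card_mono) auto
    ultimately show False using eq[of ?t] i by simp
  qed
  have eq':
    "card {i \<in> {..<Suc k}. t \<le> card (D \<inter> {..i})} = card {i \<in> {..<Suc k}. t \<le> card (E \<inter> {..i})}" for t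
    using eq[of "\<lambda>v. of_bool (t \<le> v)"]
      by (simp add: of_bool_def sum.If_cases Int_def del: sum.lessThan_Suc)
  have cards: "card (D \<inter> {..i}) = card (E \<inter> {..i})" if "i \<le> k" for i
    using le[OF that eq' fin] le[OF that eq'[symmetric] fin(2,1)] by simp
  have "D \<inter> {..i} = E \<inter> {..i}" if "i \<le> k" for i
    using that
  proof (induction i)
    case 0
    then show ?case using D by auto
  next
    case (Suc i)
    have split:
      "X \<inter> {..Suc i} = (if Suc i \<in> X then insert (Suc i) (X \<inter> {..i}) else X \<inter> {..i})" for X
      by (auto simp: le_Suc_eq)
    have "Suc i \<in> D \<longleftrightarrow> Suc i \<in> E"
      using cards[OF Suc.prems] Suc split[of D] split[of E] by (auto split: if_splits)
    then show ?case using Suc split[of D] split[of E] by simp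
  qed
  moreover have "D \<inter> {..k} = D" "E \<inter> {..k} = E" using D by auto
  ultimately show ?thesis by blast
qed

text \<open>No relation joins a multiple of \<open>d\<close> to a non-multiple, and \<open>1\<close>
  is not a multiple.\<close>

lemma not_connected_on_gap_multiples:
  assumes "d > 1" "\<And>e. e \<in> D \<Longrightarrow> d dvd e" "k \<ge> 1"
  shows "\<not> connected_on (gap D) {..<Suc k}"
proof
  assume con: "connected_on (gap D) {..<Suc k}"
  let ?T = "{i \<in> {..<Suc k}. d dvd i}"
  have "separated (gap D) ?T ({..<Suc k} - ?T)" unfolding separated_def
  proof (intro ballI)
    fix i j assume ij: "i \<in> ?T" "j \<in> {..<Suc k} - ?T"
    then have dv: "d dvd i" "\<not> d dvd j" by auto
    have "\<not> (i < j \<and> j - i \<in> D)"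
    proof
      assume *: "i < j \<and> j - i \<in> D"
      then have "d dvd (j - i) + i" using assms(2) dv(1) dvd_add by blast
      then show False using * dv(2) by simp
    qed
    moreover have "\<not> (j < i \<and> i - j \<in> D)"
    proof
      assume *: "j < i \<and> i - j \<in> D"
      then show False using assms(2)[of "i - j"] dv by (metis dvd_diffD1 less_imp_le)
    qed
    ultimately show "(i, j) \<notin> gap D \<and> (j, i) \<notin> gap D" using dv
      by (auto simp: gap_def)
  qed
  moreover have "0 \<in> ?T" by simp
  ultimately have "?T = {..<Suc k}" by (intro connected_onD[OF con]) auto
  then have "1 \<in> ?T" using assms(3) by simp
  then show False using assms(1) by simp
qed

text \<open>The down degrees of the extension are compared with those of the gap order on
  \<open>{..k}\<close>. Three test functions give the three conclusions: the identity, a threshold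
  and the triangular numbers.\<close>

lemma one_point_extension_degrees:
  assumes fin: "finite W" and q: "q \<in> W" and D: "D \<subseteq> {1..k}"
    and iso: "iso_on s (W - {q}) (gap D) {..<k}"
    and eq: "\<And>h :: nat \<Rightarrow> int. (\<Sum>y\<in>W. h (card (lower s W y))) = (\<Sum>i<Suc k. h (card (D \<inter> {..i})))"
  shows "card (lower s W q) + card (upper s W q) = card D"
    and "upper s W q \<noteq> {} \<Longrightarrow> \<exists>y\<in>upper s W q. card (lower s (W - {q}) y) = card (lower s W q)"
    and "lower s W q = {} \<Longrightarrow> (\<Sum>y\<in>upper s W q. card (lower s W y)) = (\<Sum>d\<in>D. card (D \<inter> {..d}))"
proof -
  have D0: "0 \<notin> D" and finD: "finite D" and Dk: "D \<inter> {..k} = D" using D finite_subset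
    by auto
  obtain f where f: "bij_betw f (W - {q}) {..<k}"
    and o: "\<And>x y. x \<in> W - {q} \<Longrightarrow> y \<in> W - {q} \<Longrightarrow> (x, y) \<in> s \<longleftrightarrow> (f x, f y) \<in> gap D"
    using iso unfolding iso_on_def by blast
  have finU: "finite (upper s W q)" and subU: "upper s W q \<subseteq> W - {q}" using fin
    by (auto simp: upper_def)
  \<comment> \<open>The sums over the common card cancel. What remains is the down degree
    \<open>card D\<close> of the last point \<open>k\<close> against \<open>q\<close> and the
    corrections above \<open>q\<close>.\<close>
  have step: "h (card D) = h (card (lower s W q)) +
      (\<Sum>y\<in>upper s W q. h (Suc (card (D \<inter> {..f y}))) - h (card (D \<inter> {..f y})))" for h :: "nat \<Rightarrow> int"
    using sum_lower_one_point_extension[OF fin q D0 f o, of h] eq[of h] Dk by simp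
  show deg: "card (lower s W q) + card (upper s W q) = card D"
    using step[of int] by (simp add: of_nat_add[symmetric] del: of_nat_add)
  show "\<exists>y\<in>upper s W q. card (lower s (W - {q}) y) = card (lower s W q)"
    if "upper s W q \<noteq> {}"
  proof (rule ccontr)
    assume no: "\<not> ?thesis"
    have neq: "card (D \<inter> {..f y}) \<noteq> card (lower s W q)"
      if y: "y \<in> upper s W q" for y
    proof -
      have yW: "y \<in> W - {q}" using y subU by blast
      then show ?thesis
        using card_lower_without_point[OF D0 f o yW] no y by auto
    qed
    \<comment> \<open>This threshold jumps just after the down degree of \<open>q\<close>, so only
      points above \<open>q\<close> with that same down degree in the card contribute.\<close>
    let ?h = "\<lambda>v. of_bool (card (lower s W q) < v) :: int"
    have "?h (Suc (card (D \<inter> {..f y}))) - ?h (card (D \<inter> {..f y})) = 0"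
      if "y \<in> upper s W q" for y
      using neq[OF that] by auto
    then have "?h (card D) = 0" using step[of ?h] by (simp only: sum.neutral_const sum.cong) simp
    moreover have "card (upper s W q) > 0" using that finU by (simp add: card_gt_0_iff)
    ultimately show False using deg by simp
  qed
  show "(\<Sum>y\<in>upper s W q. card (lower s W y)) = (\<Sum>d\<in>D. card (D \<inter> {..d}))"
    if "lower s W q = {}"
  proof -
    \<comment> \<open>The step of the triangular numbers to \<open>Suc v\<close> is
      \<open>Suc v\<close>, so each correction becomes the down degree in \<open>W\<close>.\<close>
    let ?h = "\<lambda>v. \<Sum>i\<le>v. int i"
    have "int (\<Sum>y\<in>upper s W q. card (lower s W y)) =
        (\<Sum>y\<in>upper s W q. ?h (Suc (card (D \<inter> {..f y}))) - ?h (card (D \<inter> {..f y})))"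
      unfolding of_nat_sum
    proof (rule sum.cong[OF refl])
      fix y assume y: "y \<in> upper s W q"
      then have "y \<in> W - {q}" using subU by blast
      then show
        "int (card (lower s W y)) = ?h (Suc (card (D \<inter> {..f y}))) - ?h (card (D \<inter> {..f y}))"
        using card_lower_one_point_extension[OF fin q D0 f o] y by simp
    qed
    also have "\<dots> = ?h (card D) - ?h 0" using step[of ?h] that by simp
    also have "\<dots> = (\<Sum>d\<in>D. ?h (card (D \<inter> {..d})) - ?h (card (D \<inter> {..d}) - 1))"
      using sum_gap_steps[OF D0, of ?h k] by (simp add: Dk)
    also have "\<dots> = int (\<Sum>d\<in>D. card (D \<inter> {..d}))"
      unfolding of_nat_sum
    proof (rule sum.cong[OF refl])
      fix d assume "d \<in> D"
      then have "card (D \<inter> {..d}) > 0" using finD by (auto simp: card_gt_0_iff)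
      then obtain c where "card (D \<inter> {..d}) = Suc c"
        by (cases "card (D \<inter> {..d})") auto
      then show
        "?h (card (D \<inter> {..d})) - ?h (card (D \<inter> {..d}) - 1) = int (card (D \<inter> {..d}))" by simp
    qed
    finally show ?thesis by (simp only: of_nat_eq_iff)
  qed
qed

section \<open>The connected case\<close>

lemma connected_minmax_reconstructible:
  assumes fin: "finite V" and card: "card V \<ge> 4" and con: "connected_on r V"
    and r: "\<And>x. x \<in> V \<Longrightarrow> (x, x) \<in> r" "antisym r" "trans r"
    and s: "\<And>x. x \<in> W \<Longrightarrow> (x, x) \<in> s" "antisym s" "trans s"
    and sc: "same_cards r V s W"
    and l: "l \<in> V" "lower r V l = {}" and h: "h \<in> V" "upper r V h = {}"
    and lh: "iso_on r (V - {h}) r (V - {l})"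
  shows "iso_on r V s W"
proof -
  have cardW: "card V = card W" using sc by (rule same_cards_card)
  have finW: "finite W" using cardW card card.infinite by fastforce
  have conW: "connected_on s W" using same_cards_connected_on[OF sc fin _ con] card by simp
  define k where "k = card V - 1"
  have k: "card V = Suc k" "card W = Suc k" "k \<ge> 3" using card cardW by (auto simp: k_def)
  obtain D where D: "D \<subseteq> {1..<card V}" and isoV: "iso_on r V (gap D) {..<card V}"
    and isoh: "iso_on r (V - {h}) (gap D) {..<card V - 1}"
    using minmax_connected_imp_iso_on_gap[OF fin con r(1) l h lh] by blast
  have D: "D \<subseteq> {1..k}" using D k(1) by auto
  have isoV: "iso_on r V (gap D) {..<Suc k}" and isoh: "iso_on r (V - {h}) (gap D) {..<k}"
    using isoV isoh k(1) by simp_all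
  have D0: "0 \<notin> D" and finD: "finite D" using D finite_subset by auto
  obtain f where f: "bij_betw f V {..<Suc k}"
    and fo: "\<And>x y. x \<in> V \<Longrightarrow> y \<in> V \<Longrightarrow> (x, y) \<in> r \<longleftrightarrow> (f x, f y) \<in> gap D"
    using isoV unfolding iso_on_def by blast
  \<comment> \<open>Transitivity along the points with coordinates \<open>0\<close>,
    \<open>d\<close> and \<open>d + e\<close>.\<close>
  have closed: "d + e \<in> D" if "d \<in> D" "e \<in> D" "d + e \<le> k" for d e
  proof -
    have "0 \<in> f ` V" "d \<in> f ` V" "d + e \<in> f ` V" using f that
      by (auto simp: bij_betw_def)
    then obtain x y z where xyz: "x \<in> V" "f x = 0" "y \<in> V" "f y = d" "z \<in> V"
      "f z = d + e" by (metis imageE)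
    have "d > 0" "e > 0" using that D0 by (metis gr0I)+
    then have "(x, y) \<in> r" "(y, z) \<in> r" using fo xyz that by (auto simp: gap_def)
    then have "(x, z) \<in> r" using r(3) by (auto dest: transD)
    then show ?thesis using fo xyz \<open>d > 0\<close> by (auto simp: gap_def)
  qed
  obtain p where p: "bij_betw p V W"
    "\<And>x. x \<in> V \<Longrightarrow> iso_on r (V - {x}) s (W - {p x})"
    using sc unfolding same_cards_def by blast
  have isolated: "\<not> (lower s W q = {} \<and> upper s W q = {})" if "q \<in> W" for q
  proof
    assume "lower s W q = {} \<and> upper s W q = {}"
    then have "separated s {q} (W - {q})" by (auto simp: separated_def lower_def upper_def)
    then have "{q} = W" using conW that by (intro connected_onD) auto
    then have "card W = 1" by auto
    then show False using k by simp
  qed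
  have "l \<noteq> h"
  proof
    assume "l = h"
    then have "separated r {l} (V - {l})" using l h
      by (auto simp: separated_def lower_def upper_def)
    then have "{l} = V" using con l(1) by (intro connected_onD) auto
    then have "card V = 1" by auto
    then show False using k by simp
  qed
  show ?thesis
  \<comment> \<open>Chains are treated separately: they have points of degree \<open>k\<close>,
    whereas Kelly's lemma determines only the moments of order below \<open>k\<close>.\<close>
  proof (cases "D = {1..k}")
    case True
    have totalV: "(x, y) \<in> r \<or> (y, x) \<in> r" if "x \<in> V" "y \<in> V" for x y
    proof -
      have "f x \<le> k" "f y \<le> k" using bij_betwE[OF f] that by (auto simp: less_Suc_eq_le)
      then show ?thesis using fo that True by (auto simp: gap_def)
    qed
    have totalW: "(x, y) \<in> s \<or> (y, x) \<in> s" if "x \<in> W" "y \<in> W" for x y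
      using same_cards_total[OF sc _ totalV that] card by simp
    have "iso_on r V {(i, j). i \<le> j} {..<card V}" using total_imp_iso_on_le[OF fin r totalV] .
    moreover have "iso_on s W {(i, j). i \<le> j} {..<card V}"
      unfolding cardW using total_imp_iso_on_le[OF finW s totalW] .
    ultimately show ?thesis using iso_on_trans iso_on_sym by blast
  next
    case False
    \<comment> \<open>A common divisor \<open>1\<close> would generate the excluded set
      \<open>{1..k}\<close>, and a larger one would disconnect the order.\<close>
    have multiples: "\<not> (\<exists>d\<in>D. \<forall>e\<in>D. d dvd e)"
    proof
      assume "\<exists>d\<in>D. \<forall>e\<in>D. d dvd e"
      then obtain d where d: "d \<in> D" "\<And>e. e \<in> D \<Longrightarrow> d dvd e" by blast
      have "d \<noteq> 1"
      proof
        assume "d = 1"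
        have "Suc i \<in> D" if "Suc i \<le> k" for i
          using that by (induction i) (use closed[of 1] d(1) \<open>d = 1\<close> in auto)
        then have "{1..k} \<subseteq> D" by (metis One_nat_def Suc_le_D atLeastAtMost_iff subsetI)
        then show False using D False by blast
      qed
      then have "d > 1" using d(1) D0 by (metis less_one linorder_neqE_nat)
      then have "\<not> connected_on (gap D) {..<Suc k}"
        using d(2) k by (intro not_connected_on_gap_multiples) auto
      then show False using iso_on_connected_on[OF isoV con] by blast
    qed
    \<comment> \<open>If \<open>D\<close> contained all of \<open>{1..<k}\<close>, it would also
      contain \<open>k\<close> as \<open>1 + (k - 1)\<close>.\<close>
    have few: "card (D \<inter> {..<k}) \<le> k - 2"
    proof -
      have "D \<inter> {..<k} \<noteq> {1..<k}"
      proof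
        assume "D \<inter> {..<k} = {1..<k}"
        then have sub: "{1..<k} \<subseteq> D" by blast
        then have "1 \<in> D" "k - 1 \<in> D" using k(3) by auto
        then have "k \<in> D" using closed[of 1 "k - 1"] k(3) by simp
        then have "{1..k} \<subseteq> D" using sub by (auto simp: le_less)
        then show False using D False by blast
      qed
      moreover have "D \<inter> {..<k} \<subseteq> {1..<k}" using D by auto
      ultimately have "card (D \<inter> {..<k}) < card {1..<k}" by (intro psubset_card_mono) auto
      then show ?thesis by simp
    qed
    have cardD: "card D \<le> k - 1"
    proof -
      have "D \<subseteq> insert k (D \<inter> {..<k})" using D by auto
      then have "card D \<le> card (insert k (D \<inter> {..<k}))" using finD
        by (intro card_mono) auto
      also have "\<dots> \<le> Suc (card (D \<inter> {..<k}))" by (simp add: card_insert_if finD)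
      finally show ?thesis using few k(3) by simp
    qed
    have boundV: "card (lower r V x) \<le> k - 1" "card (upper r V x) \<le> k - 1"
      if x: "x \<in> V" for x
    proof -
      have fx: "f x < Suc k" using bij_betwE[OF f] x by blast
      have "card (lower r V x) = card (D \<inter> {..f x})"
        using bij_betw_lower[of f V "{..<Suc k}" r "gap D" x, OF f fo x]
          card_image_subset[OF f lower_subset] card_lower_gap[OF D0 fx] by metis
      also have "\<dots> \<le> card D" using finD by (intro card_mono) auto
      finally show "card (lower r V x) \<le> k - 1" using cardD by simp
      have "card (upper r V x) = card (D \<inter> {..<Suc k - f x})"
        using bij_betw_upper[of f V "{..<Suc k}" r "gap D" x, OF f fo x]
          card_image_subset[OF f upper_subset] card_upper_gap[OF D0 fx] by metis
      also have "\<dots> \<le> card D" using finD by (intro card_mono) auto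
      finally show "card (upper r V x) \<le> k - 1" using cardD by simp
    qed
    have isoW: "iso_on s (W - {p h}) (gap D) {..<k}" "iso_on s (W - {p l}) (gap D) {..<k}"
    proof -
      show "iso_on s (W - {p h}) (gap D) {..<k}"
        using iso_on_sym[OF p(2)[OF h(1)]] isoh by (rule iso_on_trans)
      have "iso_on r (V - {l}) (gap D) {..<k}" using iso_on_sym[OF lh] isoh by (rule iso_on_trans)
      with iso_on_sym[OF p(2)[OF l(1)]] show "iso_on s (W - {p l}) (gap D) {..<k}"
        by (rule iso_on_trans)
    qed
    have pW: "p h \<in> W" "p l \<in> W" "p h \<noteq> p l"
      using p(1) h(1) l(1) \<open>l \<noteq> h\<close> by (auto simp: bij_betw_def inj_on_eq_iff)
    \<comment> \<open>Every point of \<open>W\<close> survives in one of the two known cards; its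
      degrees there are at most \<open>k - 2\<close>, and the deleted point adds at most
      one.\<close>
    have boundW: "card (lower s W y) \<le> k - 1" "card (upper s W y) \<le> k - 1"
      if y: "y \<in> W" for y
    proof -
      obtain q where q: "q \<in> W" "q \<noteq> y" "iso_on s (W - {q}) (gap D) {..<k}" using isoW pW
        by metis
      obtain g where g: "bij_betw g (W - {q}) {..<k}"
        and go: "\<And>x y. x \<in> W - {q} \<Longrightarrow> y \<in> W - {q} \<Longrightarrow> (x, y) \<in> s \<longleftrightarrow> (g x, g y) \<in> gap D"
        using q(3) unfolding iso_on_def by blast
      have yq: "y \<in> W - {q}" using y q(2) by simp
      then have gy: "g y < k" using bij_betwE[OF g] by blast
      have "card (D \<inter> {..g y}) \<le> card (D \<inter> {..<k})" using finD gy
        by (intro card_mono) auto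
      then show "card (lower s W y) \<le> k - 1"
        using card_lower_one_point_extension[OF finW q(1) D0 g go yq] few k(3)
        by (cases "y \<in> upper s W q") auto
      have "card (D \<inter> {..<k - g y}) \<le> card (D \<inter> {..<k})" using finD
        by (intro card_mono) auto
      then show "card (upper s W y) \<le> k - 1"
        using card_upper_one_point_extension[OF finW q(1) D0 g go yq] few k(3)
        by (cases "y \<in> lower s W q") auto
    qed
    \<comment> \<open>As all degrees are at most \<open>k - 1\<close>, the available moments
      determine the distribution.\<close>
    have sumL:
      "(\<Sum>x\<in>V. g (card (lower r V x))) = (\<Sum>y\<in>W. g (card (lower s W y)))" for g ::
        "nat \<Rightarrow> int"
      by (rule sum_eq_if_sum_choose_eq[OF fin finW boundV(1) boundW(1)])
        (use same_cards_sum_choose_lower[OF sc fin] k in auto)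
    have sumU:
      "(\<Sum>x\<in>V. g (card (upper r V x))) = (\<Sum>y\<in>W. g (card (upper s W y)))" for g ::
        "nat \<Rightarrow> int"
      by (rule sum_eq_if_sum_choose_eq[OF fin finW boundV(2) boundW(2)])
        (use same_cards_sum_choose_lower[OF same_cards_converse[OF sc] fin] k in auto)
    \<comment> \<open>Kelly's lemma for three-element sets needs a fourth point.\<close>
    have prod:
      "(\<Sum>x\<in>V. card (lower r V x) * card (upper r V x)) = (\<Sum>y\<in>W. card (lower s W y) * card (upper s W y))"
      using same_cards_sum_lower_upper[OF sc fin _ r(2) s(2)] card by simp
    \<comment> \<open>Along the coordinate \<open>f\<close>, down degrees never fall and up degrees
      never rise.\<close>
    have antiV: "card (upper r V x) \<ge> card (upper r V y)"
      if xy: "x \<in> V" "y \<in> V" "card (lower r V x) < card (lower r V y)" for x y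
    proof -
      have fxy: "f x < Suc k" "f y < Suc k" using bij_betwE[OF f] xy by blast+
      have low: "card (lower r V z) = card (D \<inter> {..f z})"
        "card (upper r V z) = card (D \<inter> {..<Suc k - f z})"
        if z: "z \<in> V" for z
      proof -
        have fz: "f z < Suc k" using bij_betwE[OF f] z by blast
        show "card (lower r V z) = card (D \<inter> {..f z})"
          using bij_betw_lower[of f V "{..<Suc k}" r "gap D" z, OF f fo z]
            card_image_subset[OF f lower_subset] card_lower_gap[OF D0 fz] by metis
        show "card (upper r V z) = card (D \<inter> {..<Suc k - f z})"
          using bij_betw_upper[of f V "{..<Suc k}" r "gap D" z, OF f fo z]
            card_image_subset[OF f upper_subset] card_upper_gap[OF D0 fz] by metis
      qed
      have "f x < f y"
      proof (rule ccontr)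
        assume "\<not> f x < f y"
        then have "card (D \<inter> {..f y}) \<le> card (D \<inter> {..f x})" using finD
          by (intro card_mono) auto
        then show False using xy low by simp
      qed
      then have "card (D \<inter> {..<Suc k - f y}) \<le> card (D \<inter> {..<Suc k - f x})"
        using finD by (intro card_mono) auto
      then show ?thesis using low xy by simp
    qed
    have antiW: "card (upper s W x) \<ge> card (upper s W y)"
      if "x \<in> W" "y \<in> W" "card (lower s W x) < card (lower s W y)" for x y
      by (rule antitone_transfer[OF fin finW sumL sumU prod antiV that])
    have gapL:
      "(\<Sum>y\<in>W. g (card (lower s W y))) = (\<Sum>i<Suc k. g (card (D \<inter> {..i})))" for g :: "nat \<Rightarrow> int"
      using iso_on_sum_lower[OF isoV, of g] sumL[of g] card_lower_gap[OF D0, of _ "Suc k"] by simp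
    have gapU:
      "(\<Sum>y\<in>W. g (card (lower (s\<inverse>) W y))) = (\<Sum>i<Suc k. g (card (D \<inter> {..i})))" for g :: "nat \<Rightarrow> int"
    proof -
      have "iso_on (r\<inverse>) V (gap D) {..<Suc k}"
        using iso_on_converse[OF isoV] gap_self_dual by (rule iso_on_trans)
      from iso_on_sum_lower[OF this, of g] show ?thesis
        using sumU[of g] card_lower_gap[OF D0, of _ "Suc k"] by simp
    qed
    \<comment> \<open>Reversing the order and reflecting the coordinates leads back to the same gap
      order, so the results on down degrees apply to up degrees.\<close>
    have dual: "iso_on (s\<inverse>) (W - {q}) (gap D) {..<k}"
      if "iso_on s (W - {q}) (gap D) {..<k}" for q
      using iso_on_converse[OF that] gap_self_dual by (rule iso_on_trans)
    note degL = one_point_extension_degrees[OF finW _ D _ gapL]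
    note degU = one_point_extension_degrees[OF finW _ D dual gapU, unfolded lower_converse upper_converse]
    have extreme: "lower s W q = {} \<or> upper s W q = {}"
      if q: "q \<in> W" "iso_on s (W - {q}) (gap D) {..<k}" for q
    proof (rule ccontr)
      assume "\<not> ?thesis"
      then have ne: "upper s W q \<noteq> {}" "lower s W q \<noteq> {}" by auto
      obtain g where g: "bij_betw g (W - {q}) {..<k}"
        and go: "\<And>x y. x \<in> W - {q} \<Longrightarrow> y \<in> W - {q} \<Longrightarrow> (x, y) \<in> s \<longleftrightarrow> (g x, g y) \<in> gap D"
        using q(2) unfolding iso_on_def by blast
      obtain y where y: "y \<in> upper s W q" "card (lower s (W - {q}) y) = card (lower s W q)"
        using degL(2)[OF q ne(1)] by blast
      obtain x where x: "x \<in> lower s W q" "card (upper s (W - {q}) x) = card (upper s W q)"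
        using degU(2)[OF q ne(2)] by blast
      show False
        using not_between_imp_multiples[OF finW q(1) s(3) D closed g go degL(1)[OF q] x y antiW s(2)] multiples
        by blast
    qed
    \<comment> \<open>A minimal and a maximal point with isomorphic cards make \<open>W\<close> a
      gap order for some \<open>E\<close>, and the down degrees force \<open>D = E\<close>.\<close>
    have reconstruct: "iso_on r V s W"
      if q: "q \<in> W" "lower s W q = {}" "iso_on s (W - {q}) (gap D) {..<k}"
        and q': "q' \<in> W" "upper s W q' = {}" "iso_on s (W - {q'}) (gap D) {..<k}" for q q'
    proof -
      have "iso_on s (W - {q'}) s (W - {q})" using q'(3) iso_on_sym[OF q(3)] by (rule iso_on_trans)
      then obtain E where E: "E \<subseteq> {1..<card W}" "iso_on s W (gap E) {..<card W}"
        using minmax_connected_imp_iso_on_gap[OF finW conW s(1) q(1,2) q'(1,2)] by blast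
      have Ek: "E \<subseteq> {1..k}" and E0: "0 \<notin> E" using E(1) k by auto
      have isoE: "iso_on s W (gap E) {..<Suc k}" using E(2) k by simp
      have "D = E"
      proof (rule gap_determined[OF D Ek])
        fix g :: "nat \<Rightarrow> int"
        show "(\<Sum>i<Suc k. g (card (D \<inter> {..i}))) = (\<Sum>i<Suc k. g (card (E \<inter> {..i})))"
          using iso_on_sum_lower[OF isoE, of g] gapL[of g] card_lower_gap[OF E0, of _ "Suc k"]
            by simp
      qed
      then show ?thesis using iso_on_trans[OF isoV iso_on_sym[OF isoE[folded \<open>D = E\<close>]]]
        by simp
    qed
    have not_min: "\<not> (lower s W (p h) = {} \<and> lower s W (p l) = {})"
    proof
      assume min: "lower s W (p h) = {} \<and> lower s W (p l) = {}"
      have "\<not> connected_on s W"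
        using two_minimal_points_not_connected_on[OF finW s(2) pW _ _ D isoW]
          degL(1,3)[OF pW(1) isoW(1)] degL(1,3)[OF pW(2) isoW(2)] min by simp
      then show False using conW by blast
    qed
    have not_max: "\<not> (upper s W (p h) = {} \<and> upper s W (p l) = {})"
    proof
      assume max: "upper s W (p h) = {} \<and> upper s W (p l) = {}"
      have "antisym (s\<inverse>)" using s(2) by simp
      then have "\<not> connected_on (s\<inverse>) W"
        using two_minimal_points_not_connected_on[OF finW _ pW _ _ D dual[OF isoW(1)]
          dual[OF isoW(2)]]
          degU(1,3)[OF pW(1) isoW(1)] degU(1,3)[OF pW(2) isoW(2)] max by simp
      then show False using conW by (simp add: connected_on_converse)
    qed
    consider "lower s W (p h) = {}" "upper s W (p l) = {}" | "lower s W (p l) = {}" "upper s W (p h) = {}"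
      using extreme[OF pW(1) isoW(1)] extreme[OF pW(2) isoW(2)] not_min not_max by blast
    then show ?thesis
    proof cases
      case 1
      then show ?thesis using reconstruct[OF pW(1) _ isoW(1) pW(2) _ isoW(2)] by blast
    next
      case 2
      then show ?thesis using reconstruct[OF pW(2) _ isoW(2) pW(1) _ isoW(1)] by blast
    qed
  qed
qed

theorem theorem1p3:
  fixes P :: "'a rel" and Q :: "'b rel"
  assumes "Partial_order P" and "finite (Field P)" and "card (Field P) \<ge> 4"
    and "\<exists>l h. minmax_pseudo_similar P l h"
    and "Partial_order Q" and "deck Q = deck P"
  shows "isomorphic Q P"
proof -
  have P: "Refl P" "antisym P" "trans P" and Q: "Refl Q" "antisym Q" "trans Q"
    using assms(1,5) by (auto simp: order_on_defs)
  have "Field P \<noteq> {}" using assms(3) by auto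
  then have sc: "same_cards P (Field P) Q (Field Q)"
    using deck_eq_imp_bij_betw(2)[OF assms(1,2) _ assms(5,6)] by (simp add: same_cards_def)
  have "iso_on P (Field P) Q (Field Q)"
  proof (cases "connected_on P (Field P)")
    case False
    then show ?thesis using disconnected_reconstructible[OF sc assms(2)] assms(3) by simp
  next
    case True
    obtain l h where lh: "minimal_point P l" "maximal_point P h"
      "isomorphic (delete_point P h) (delete_point P l)"
      using assms(4) unfolding minmax_pseudo_similar_def by blast
    show ?thesis
    proof (rule connected_minmax_reconstructible[OF assms(2,3) True _ P(2,3) _ Q(2,3) sc])
      show "l \<in> Field P" "lower P (Field P) l = {}"
        using lh(1) by (auto simp: minimal_point_def lower_def)
      show "h \<in> Field P" "upper P (Field P) h = {}"
        using lh(2) by (auto simp: maximal_point_def upper_def)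
      show "iso_on P (Field P - {h}) P (Field P - {l})"
        using lh(3) isomorphic_delete_point_iff[OF P(1) P(1)] by blast
    qed (use P(1) Q(1) in \<open>auto dest: refl_onD\<close>)
  qed
  then show ?thesis unfolding isomorphic_iff_iso_on by (rule iso_on_sym)
qed

end
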